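(* Let $T$ be a countable Dedekind domain such that $T/J$ is finite for every nonzero proper ideal $J\subset T$, equipped with the discrete $\sigma$-algebra. Let $\mathcal{I}$ be the set of all nonzero ideals $I$ of $T$ such that $T/I$ is an elementary abelian group, and let $\epsilon\in\mathbb{R}_{>0}^{\mathcal{I}}$. Let $P=\{\mathfrak{p}_1,\dots,\mathfrak{p}_k\}$ be a finite set of nonzero prime ideals of $T$ and let $T_{\mathfrak{p}_i}=\varprojlim_m T/\mathfrak{p}_i^m$. Let $u$ be a positive integer and, for each $n$, let $M(n)$ be an $\epsilon$-balanced $n\times(n+u)$ random matrix with entries in $T$. Then \[\lim_{n\to\infty}\mathbb{P}\left(\mathrm{cok}(M(n))\otimes \prod_{i=1}^kT_{\mathfrak{p}_i}\ \text{is finite}\right)=1.\]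
   Context: An abelian group is elementary abelian if it is isomorphic to $(\mathbb{Z}/p\mathbb{Z})^m$ for some prime $p$ and integer $m>0$. If $V$ is an $\mathbb{F}_p$-vector space, a random variable $y$ in $V$ is $\epsilon'$-balanced if $\mathbb{P}(y\in H)\leq 1-\epsilon'$ for every proper affine $\mathbb{F}_p$-subspace $H\subset V$. A random variable $y$ valued in $T$ is $\epsilon$-balanced (with $\epsilon=(\epsilon_I)_{I\in\mathcal{I}}$) if for every $I\in\mathcal{I}$ the image of $y$ in $T/I$ is $\epsilon_I$-balanced. A random matrix with entries in $T$ is $\epsilon$-balanced if its entries are independent and each is $\epsilon$-balanced. $\mathrm{cok}(M)=T^n/M(T^{n+u})$. *)

theory Defs
  imports "HOL-Probability.Probability" "HOL-Computational_Algebra.Primes"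
begin

definition is_ideal :: "'a::comm_ring_1 set \<Rightarrow> bool" where
  "is_ideal I \<longleftrightarrow> 0 \<in> I \<and> (\<forall>x\<in>I. \<forall>y\<in>I. x + y \<in> I) \<and> (\<forall>x\<in>I. - x \<in> I)
      \<and> (\<forall>r. \<forall>x\<in>I. r * x \<in> I)"

definition is_prime_ideal :: "'a::comm_ring_1 set \<Rightarrow> bool" where
  "is_prime_ideal p \<longleftrightarrow> is_ideal p \<and> p \<noteq> UNIV \<and> (\<forall>a b. a * b \<in> p \<longrightarrow> a \<in> p \<or> b \<in> p)"

definition is_maximal_ideal :: "'a::comm_ring_1 set \<Rightarrow> bool" where
  "is_maximal_ideal p \<longleftrightarrow> is_ideal p \<and> p \<noteq> UNIV \<and>
      (\<forall>J. is_ideal J \<and> p \<subseteq> J \<longrightarrow> J = p \<or> J = UNIV)"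

definition ideal_gen :: "'a::comm_ring_1 set \<Rightarrow> 'a set" where
  "ideal_gen S = \<Inter> {I. is_ideal I \<and> S \<subseteq> I}"

fun ideal_pow :: "'a::comm_ring_1 set \<Rightarrow> nat \<Rightarrow> 'a set" where
  "ideal_pow p 0 = UNIV"
| "ideal_pow p (Suc m) = ideal_gen {a * b | a b. a \<in> p \<and> b \<in> ideal_pow p m}"

definition ideal_rel :: "'a::comm_ring_1 set \<Rightarrow> ('a \<times> 'a) set" where
  "ideal_rel J = {(x, y). x - y \<in> J}"

definition quot :: "'a::comm_ring_1 set \<Rightarrow> 'a set set" where
  "quot J = UNIV // ideal_rel J"

text \<open>Classical definition: a Noetherian integrally closed domain in which every nonzero
  prime ideal is maximal.  Integral closedness is stated without the fraction field:
  if \<open>a/b\<close> (with \<open>b \<noteq> 0\<close>) is a root of a monic polynomial over \<open>T\<close>, then \<open>b\<close> divides \<open>a\<close>.\<close>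
definition dedekind_domain :: "'a::idom itself \<Rightarrow> bool" where
  "dedekind_domain _ \<longleftrightarrow>
     (\<forall>I::'a set. is_ideal I \<longrightarrow> (\<exists>S. finite S \<and> I = ideal_gen S)) \<and>
     (\<forall>a b::'a. \<forall>d::nat. \<forall>c::nat \<Rightarrow> 'a. b \<noteq> 0 \<and>
         a ^ Suc d + (\<Sum>i\<le>d. c i * a ^ i * b ^ (Suc d - i)) = 0 \<longrightarrow> b dvd a) \<and>
     (\<forall>p::'a set. is_prime_ideal p \<and> p \<noteq> {0} \<longrightarrow> is_maximal_ideal p)"

definition finite_residues :: "'a::comm_ring_1 itself \<Rightarrow> bool" where
  "finite_residues _ \<longleftrightarrow>
     (\<forall>J::'a set. is_ideal J \<and> J \<noteq> {0} \<and> J \<noteq> UNIV \<longrightarrow> finite (quot J))"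

text \<open>The additive group \<open>T/I\<close> is isomorphic to \<open>(\<int>/p\<int>)^m\<close> for a prime \<open>p\<close> and \<open>m > 0\<close>.
  The isomorphism is given on representatives: \<open>f\<close> maps \<open>{..<m} \<rightarrow> {..<p}\<close> to \<open>T\<close>, and
  \<open>x \<mapsto> f x mod I\<close> is an additive bijection onto \<open>T/I\<close>.\<close>
definition elem_abelian_quot :: "'a::comm_ring_1 set \<Rightarrow> bool" where
  "elem_abelian_quot I \<longleftrightarrow>
     (\<exists>(p::nat) (m::nat) (f::(nat \<Rightarrow> nat) \<Rightarrow> 'a). prime p \<and> m > 0 \<and>
        (let V = {..<m} \<rightarrow>\<^sub>E {..<p} in
          (\<forall>x\<in>V. \<forall>y\<in>V. f (restrict (\<lambda>i. (x i + y i) mod p) {..<m}) - f x - f y \<in> I) \<and>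
          (\<forall>t. \<exists>x\<in>V. t - f x \<in> I) \<and>
          (\<forall>x\<in>V. \<forall>y\<in>V. f x - f y \<in> I \<longrightarrow> x = y)))"

definition Ical :: "'a::comm_ring_1 set set" where
  "Ical = {I. is_ideal I \<and> I \<noteq> {0} \<and> elem_abelian_quot I}"

text \<open>A proper affine \<open>\<bbbF>_p\<close>-subspace of the elementary abelian group \<open>T/I\<close> is a coset of a
  proper subgroup of \<open>T/I\<close>; its preimage in \<open>T\<close> is \<open>a + W\<close> with \<open>W\<close> an additive subgroup
  of \<open>T\<close> with \<open>I \<subseteq> W \<noteq> T\<close>.\<close>
definition add_subgroup :: "'a::ab_group_add set \<Rightarrow> bool" where
  "add_subgroup W \<longleftrightarrow> 0 \<in> W \<and> (\<forall>x\<in>W. \<forall>y\<in>W. x + y \<in> W) \<and> (\<forall>x\<in>W. - x \<in> W)"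

definition quot_balanced :: "'a::comm_ring_1 set \<Rightarrow> real \<Rightarrow> 'a pmf \<Rightarrow> bool" where
  "quot_balanced I e y \<longleftrightarrow>
     (\<forall>W a. add_subgroup W \<and> I \<subseteq> W \<and> W \<noteq> UNIV \<longrightarrow>
        measure_pmf.prob y {t. t - a \<in> W} \<le> 1 - e)"

definition eps_balanced :: "('a::comm_ring_1 set \<Rightarrow> real) \<Rightarrow> 'a pmf \<Rightarrow> bool" where
  "eps_balanced \<epsilon> y \<longleftrightarrow> (\<forall>I\<in>Ical. quot_balanced I (\<epsilon> I) y)"

text \<open>An element of \<open>T_p = lim T/p^m\<close> is represented by a compatible sequence \<open>x\<close>
  (\<open>x m\<close> represents an element of \<open>T/p^m\<close>); two sequences are equal in \<open>T_p\<close> iff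
  \<open>x m - y m \<in> p^m\<close> for all \<open>m\<close>.\<close>
definition compatible_seq :: "'a::comm_ring_1 set \<Rightarrow> (nat \<Rightarrow> 'a) \<Rightarrow> bool" where
  "compatible_seq p x \<longleftrightarrow> (\<forall>m. x (Suc m) - x m \<in> ideal_pow p m)"

definition compl_prod :: "'a::comm_ring_1 set set \<Rightarrow> ('a set \<Rightarrow> nat \<Rightarrow> 'a) set" where
  "compl_prod P = {a. (\<forall>p\<in>P. compatible_seq p (a p)) \<and> (\<forall>p. p \<notin> P \<longrightarrow> a p = (\<lambda>_. 0))}"

definition Avec :: "'a::comm_ring_1 set set \<Rightarrow> nat \<Rightarrow> (nat \<Rightarrow> 'a set \<Rightarrow> nat \<Rightarrow> 'a) set" where
  "Avec P n = {v. (\<forall>r<n. v r \<in> compl_prod P) \<and> (\<forall>r\<ge>n. v r = (\<lambda>_ _. 0))}"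

definition cok_tensor_rel ::
  "'a::comm_ring_1 set set \<Rightarrow> nat \<Rightarrow> nat \<Rightarrow> (nat \<times> nat \<Rightarrow> 'a)
     \<Rightarrow> ((nat \<Rightarrow> 'a set \<Rightarrow> nat \<Rightarrow> 'a) \<times> (nat \<Rightarrow> 'a set \<Rightarrow> nat \<Rightarrow> 'a)) set" where
  "cok_tensor_rel P n u M =
     {(v, v'). v \<in> Avec P n \<and> v' \<in> Avec P n \<and>
        (\<exists>w\<in>Avec P (n + u). \<forall>r<n. \<forall>p\<in>P. \<forall>m.
           v r p m - v' r p m - (\<Sum>c<n + u. M (r, c) * w c p m) \<in> ideal_pow p m)}"

text \<open>\<open>cok(M) \<otimes>_T A \<cong> A^n / M(A^(n+u))\<close> (right exactness of \<open>\<otimes>\<close>).\<close>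
definition cok_tensor ::
  "'a::comm_ring_1 set set \<Rightarrow> nat \<Rightarrow> nat \<Rightarrow> (nat \<times> nat \<Rightarrow> 'a)
     \<Rightarrow> (nat \<Rightarrow> 'a set \<Rightarrow> nat \<Rightarrow> 'a) set set" where
  "cok_tensor P n u M = Avec P n // cok_tensor_rel P n u M"

definition matrix_law :: "nat \<Rightarrow> nat \<Rightarrow> (nat \<Rightarrow> nat \<Rightarrow> 'a::zero pmf) \<Rightarrow> (nat \<times> nat \<Rightarrow> 'a) pmf" where
  "matrix_law n u \<mu> = Pi_pmf ({..<n} \<times> {..<n + u}) 0 (\<lambda>(i, j). \<mu> i j)"

end

theory Submission
  imports Defs "Jordan_Normal_Form.Determinant"
begin

text \<open>
  If the first \<open>n\<close> columns of the matrix have determinant \<open>D \<noteq> 0\<close>, then multiplication by the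
  adjugate shows that \<open>D\<close> annihilates the completed cokernel, which is therefore finite. That
  \<open>D \<noteq> 0\<close> with probability tending to 1 is proved in the style of Komlos. A column lies in the span
  of the \<open>j\<close> columns before it with probability at most \<open>q\<^sup>n\<^sup>-\<^sup>j\<close>, where \<open>q < 1\<close> bounds all point
  masses (Odlyzko); the sum over \<open>j < n - L\<close> is small once \<open>L\<close> is large. For the last \<open>L\<close> columns,
  the same bound applied to rows shows that, with high probability, no nonzero vector with a bounded
  number of nonzero coordinates annihilates the first \<open>n - L\<close> columns. Hence some linear form with
  many nonzero coefficients annihilates the preceding columns, and it vanishes on the next column
  with small probability, because such forms in balanced variables do not concentrate at a point:
  this is seen \<open>p\<close>-adically, for any one \<open>p \<in> P\<close>.
\<close>

unbundle no vec_syntax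


section \<open>Ideals of noetherian rings\<close>

interpretation regular: Modules.module "(*) :: 'a::comm_ring_1 \<Rightarrow> 'a \<Rightarrow> 'a"
  by unfold_locales (auto simp: algebra_simps)

declare regular.scale_scale [simp del]

lemma is_ideal_iff_subspace: "is_ideal I \<longleftrightarrow> regular.subspace I"
  unfolding is_ideal_def using regular.subspace_neg[of I] by (auto simp: regular.subspace_def)

lemma ideal_gen_eq_span: "ideal_gen S = regular.span S"
  by (simp add: ideal_gen_def regular.span_def hull_def is_ideal_iff_subspace)

lemmas ideal_zero = regular.subspace_0[folded is_ideal_iff_subspace]
  and ideal_add = regular.subspace_add[folded is_ideal_iff_subspace]
  and ideal_minus = regular.subspace_neg[folded is_ideal_iff_subspace]
  and ideal_diff = regular.subspace_diff[folded is_ideal_iff_subspace]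
  and ideal_mult_left = regular.subspace_scale[folded is_ideal_iff_subspace]
  and ideal_sum = regular.subspace_sum[folded is_ideal_iff_subspace]
  and is_ideal_ideal_gen = regular.subspace_span[folded is_ideal_iff_subspace ideal_gen_eq_span]
  and ideal_gen_superset = regular.span_superset[folded ideal_gen_eq_span]
  and ideal_gen_least = regular.span_minimal[folded is_ideal_iff_subspace ideal_gen_eq_span]

lemma ideal_mult_right: "is_ideal I \<Longrightarrow> x \<in> I \<Longrightarrow> x * r \<in> I"
  using ideal_mult_left[of I x r] by (simp add: mult.commute)

lemma is_ideal_ideal_pow: "is_ideal (ideal_pow p k)"
  by (cases k) (simp_all add: is_ideal_ideal_gen, simp add: is_ideal_iff_subspace)

lemma ideal_eq_UNIV_iff: "is_ideal I \<Longrightarrow> I = UNIV \<longleftrightarrow> 1 \<in> I"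
  using ideal_mult_left[of I 1] by auto

lemma is_ideal_dvd_mult: "is_ideal {x. a dvd b * x}"
  by (auto simp: is_ideal_def distrib_left mult.left_commute[of b])

lemma is_ideal_plus:
  assumes "is_ideal I" "is_ideal J"
  shows "is_ideal (I + J)"
proof -
  have "is_ideal (ideal_gen (I \<union> J))" by (rule is_ideal_ideal_gen)
  moreover have "ideal_gen (I \<union> J) = I + J"
    using assms unfolding is_ideal_iff_subspace ideal_gen_eq_span regular.span_Un set_plus_def
    by (auto simp: regular.span_eq_iff[THEN iffD2])
  ultimately show ?thesis by simp
qed

lemma ideal_subset_plus: "is_ideal J \<Longrightarrow> I \<subseteq> I + J"
  using set_zero_plus2[of J I] ideal_zero[of J] by (simp add: add.commute)

definition noetherian :: "'a::comm_ring_1 itself \<Rightarrow> bool" where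
  "noetherian _ \<longleftrightarrow> (\<forall>I::'a set. is_ideal I \<longrightarrow> (\<exists>S. finite S \<and> I = ideal_gen S))"

lemma ideal_gen_atMostE:
  fixes g :: "nat \<Rightarrow> 'a::comm_ring_1"
  assumes "x \<in> ideal_gen (g ` {..k})"
  obtains r where "x = (\<Sum>i\<le>k. r i * g i)"
proof -
  have "\<exists>r. x = (\<Sum>i\<le>k. r i * g i)"
    using assms unfolding ideal_gen_eq_span
  proof (induction k arbitrary: x)
    case 0
    then show ?case by (auto simp: regular.span_singleton)
  next
    case (Suc k)
    then obtain c where "x - c * g (Suc k) \<in> regular.span (g ` {..k})"
      by (auto simp: atMost_Suc regular.span_breakdown_eq)
    from Suc.IH[OF this] obtain r where "x - c * g (Suc k) = (\<Sum>i\<le>k. r i * g i)" ..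
    then have "x = (\<Sum>i\<le>k. (r(Suc k := c)) i * g i) + c * g (Suc k)"
      by (simp add: diff_eq_eq)
    then show ?case by (intro exI[of _ "r(Suc k := c)"]) simp
  qed
  then show thesis using that by blast
qed

lemma noetherian_sequenceE:
  fixes g :: "nat \<Rightarrow> 'a::comm_ring_1"
  assumes "noetherian TYPE('a)"
  obtains k r where "g (Suc k) = (\<Sum>i\<le>k. r i * g i)"
proof -
  have mono: "ideal_gen (g ` {..i}) \<subseteq> ideal_gen (g ` {..j})" if "i \<le> j" for i j
    unfolding ideal_gen_eq_span using that by (intro regular.span_mono) auto
  have bounded: "\<exists>k. x \<in> ideal_gen (g ` {..k})" if "x \<in> ideal_gen (range g)" for x
    using that unfolding ideal_gen_eq_span
  proof (induction rule: regular.span_induct_alt)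
    case base
    show ?case using regular.span_zero by blast
  next
    case (step c x y)
    then obtain i k where "x = g i" "y \<in> ideal_gen (g ` {..k})"
      by (auto simp: ideal_gen_eq_span)
    then have "x \<in> ideal_gen (g ` {..max i k})" "y \<in> ideal_gen (g ` {..max i k})"
      using mono[of k "max i k"] ideal_gen_superset[of "g ` {..max i k}"] by auto
    then show ?case
      unfolding ideal_gen_eq_span by (blast intro: regular.span_add regular.span_scale)
  qed
  obtain S where S: "finite S" "ideal_gen (range g) = ideal_gen S"
    using assms is_ideal_ideal_gen unfolding noetherian_def by blast
  have "\<forall>x\<in>S. \<exists>k. x \<in> ideal_gen (g ` {..k})"
    using bounded S(2) ideal_gen_superset by blast
  then obtain h where h: "\<And>x. x \<in> S \<Longrightarrow> x \<in> ideal_gen (g ` {..h x})" by metis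
  obtain k where "\<And>x. x \<in> S \<Longrightarrow> h x \<le> k"
    using S(1) finite_nat_set_iff_bounded_le[of "h ` S"] by auto
  then have "S \<subseteq> ideal_gen (g ` {..k})" using h mono by blast
  then have "g (Suc k) \<in> ideal_gen (g ` {..k})"
    using S(2) ideal_gen_least[OF _ is_ideal_ideal_gen] ideal_gen_superset[of "range g"] by blast
  then show thesis by (rule ideal_gen_atMostE) (rule that)
qed

lemma noetherian_maximal_ideal:
  fixes \<F> :: "'a::comm_ring_1 set set"
  assumes noeth: "noetherian TYPE('a)" and "J0 \<in> \<F>" and ideals: "\<And>J. J \<in> \<F> \<Longrightarrow> is_ideal J"
  shows "\<exists>M\<in>\<F>. \<forall>J\<in>\<F>. M \<subseteq> J \<longrightarrow> J = M"
proof (rule ccontr)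
  assume "\<not> ?thesis"
  then have "\<exists>J'. J' \<in> \<F> \<and> J \<subset> J'" if "J \<in> \<F>" for J
    using that unfolding psubset_eq by metis
  with \<open>J0 \<in> \<F>\<close> have "\<exists>C. \<forall>k. C k \<in> \<F> \<and> C k \<subset> C (Suc k)"
    by (intro dependent_nat_choice) auto
  then obtain C where C: "\<And>k. C k \<in> \<F>" "\<And>k. C k \<subset> C (Suc k)" by metis
  from C(2) have "\<exists>x. x \<in> C (Suc k) - C k" for k by blast
  then obtain x where x: "\<And>k. x k \<in> C (Suc k) - C k" by metis
  obtain k r where "x (Suc k) = (\<Sum>i\<le>k. r i * x i)"
    using noeth by (rule noetherian_sequenceE)
  moreover have "(\<Sum>i\<le>k. r i * x i) \<in> C (Suc k)"
  proof (intro ideal_sum ideal_mult_left ideals C(1))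
    fix i assume "i \<in> {..k}"
    then have "C (Suc i) \<subseteq> C (Suc k)"
      using lift_Suc_mono_le[of C "Suc i" "Suc k", OF psubset_imp_subset[OF C(2)]] by simp
    then show "x i \<in> C (Suc k)" using x by blast
  qed
  ultimately show False using x[of "Suc k"] by simp
qed


section \<open>Nonzero primes of Dedekind domains\<close>

lemma dedekind_noetherian: "dedekind_domain TYPE('a::idom) \<Longrightarrow> noetherian TYPE('a)"
  by (simp add: dedekind_domain_def noetherian_def)

lemma dedekind_integrally_closed:
  fixes a b :: "'a::idom"
  assumes "dedekind_domain TYPE('a)" "b \<noteq> 0"
    and "a ^ Suc d = (\<Sum>i\<le>d. c i * a ^ i * b ^ (Suc d - i))"
  shows "b dvd a"
proof -
  have "b \<noteq> 0 \<and> a ^ Suc d + (\<Sum>i\<le>d. (- c i) * a ^ i * b ^ (Suc d - i)) = 0"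
    using assms(2,3) by (simp add: sum_negf)
  from assms(1)[unfolded dedekind_domain_def, THEN conjunct2, THEN conjunct1, rule_format, OF this]
  show ?thesis .
qed

text \<open>If \<open>(b/a) p \<subseteq> p\<close>, then in the noetherian ring \<open>T\<close> the sequence \<open>c, c(b/a), c(b/a)\<^sup>2, \<dots>\<close>, for a
  fixed nonzero \<open>c \<in> p\<close>, satisfies a linear relation, which is an equation of integral dependence
  for \<open>b/a\<close>.\<close>
lemma dvd_of_stable_ideal:
  fixes a b :: "'a::idom"
  assumes ded: "dedekind_domain TYPE('a)" and c: "c \<in> p" "c \<noteq> 0" and a: "a \<noteq> 0"
    and stable: "\<And>x. x \<in> p \<Longrightarrow> \<exists>y\<in>p. b * x = a * y"
  shows "a dvd b"
proof -
  from stable obtain f where f: "f x \<in> p" "b * x = a * f x" if "x \<in> p" for x by metis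
  define g where "g k = (f ^^ k) c" for k
  have g_mem: "g k \<in> p" for k
    by (induction k) (auto simp: g_def c f)
  have g_eq: "a ^ k * g k = b ^ k * c" for k
  proof (induction k)
    case (Suc k)
    have "a ^ Suc k * g (Suc k) = b * (a ^ k * g k)"
      using f(2)[OF g_mem[of k]] by (simp add: g_def mult.left_commute)
    then show ?case by (simp add: Suc mult.assoc)
  qed (simp add: g_def)
  obtain k r where r: "g (Suc k) = (\<Sum>i\<le>k. r i * g i)"
    using dedekind_noetherian[OF ded] by (rule noetherian_sequenceE)
  have "b ^ Suc k * c = (\<Sum>i\<le>k. a ^ Suc k * (r i * g i))"
    by (simp only: g_eq[symmetric] r sum_distrib_left)
  also have "\<dots> = (\<Sum>i\<le>k. r i * b ^ i * a ^ (Suc k - i) * c)"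
  proof (rule sum.cong[OF refl])
    fix i assume "i \<in> {..k}"
    then have "a ^ Suc k = a ^ (Suc k - i) * a ^ i" by (simp flip: power_add)
    then have "a ^ Suc k * (r i * g i) = r i * a ^ (Suc k - i) * (a ^ i * g i)"
      by (simp only: ac_simps)
    then show "a ^ Suc k * (r i * g i) = r i * b ^ i * a ^ (Suc k - i) * c"
      by (simp only: g_eq) (simp only: ac_simps)
  qed
  finally have "b ^ Suc k = (\<Sum>i\<le>k. r i * b ^ i * a ^ (Suc k - i))"
    using c(2) by (simp flip: sum_distrib_right)
  with ded a show ?thesis by (rule dedekind_integrally_closed)
qed

definition conductor :: "'a::comm_ring_1 \<Rightarrow> 'a \<Rightarrow> 'a set" where
  "conductor a b = {x. a dvd b * x}"

lemma maximal_conductor_prime: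
  fixes p :: "'a::idom set"
  assumes prime: "is_prime_ideal p" and b: "conductor a b \<subseteq> p"
    and maximal: "\<And>b'. conductor a b' \<subseteq> p \<Longrightarrow> conductor a b \<subseteq> conductor a b' \<Longrightarrow>
      conductor a b' = conductor a b"
  shows "is_prime_ideal (conductor a b)"
  unfolding is_prime_ideal_def
proof (intro conjI allI impI)
  have maximal_mult: "conductor a (b * y) = conductor a b" if "conductor a (b * y) \<subseteq> p" for y
    using that by (rule maximal) (auto simp: conductor_def mult.assoc mult.left_commute[of b y])
  show "is_ideal (conductor a b)" unfolding conductor_def by (rule is_ideal_dvd_mult)
  show "conductor a b \<noteq> UNIV" using b prime by (auto simp: is_prime_ideal_def)
  fix x y assume xy: "x * y \<in> conductor a b"
  show "x \<in> conductor a b \<or> y \<in> conductor a b"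
  proof (cases "conductor a (b * y) \<subseteq> p")
    case True
    then show ?thesis using maximal_mult[OF True] xy by (auto simp: conductor_def ac_simps)
  next
    case False
    then obtain s where s: "s \<notin> p" "a dvd b * y * s" by (auto simp: conductor_def)
    have "conductor a (b * s) \<subseteq> p"
    proof
      fix z assume "z \<in> conductor a (b * s)"
      then have "s * z \<in> p" using b by (auto simp: conductor_def mult.assoc)
      then show "z \<in> p" using prime s(1) by (auto simp: is_prime_ideal_def)
    qed
    then have "conductor a (b * s) = conductor a b" by (rule maximal_mult)
    moreover have "y \<in> conductor a (b * s)" using s(2) by (simp add: conductor_def ac_simps)
    ultimately show ?thesis by blast
  qed
qed

text \<open>A maximal one among the conductors \<open>(a : b)\<close> contained in \<open>p\<close>, for a fixed nonzero \<open>a \<in> p\<close>, is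
  prime, hence a maximal ideal, hence equal to \<open>p\<close>.\<close>
lemma prime_ideal_eq_conductor:
  fixes p :: "'a::idom set"
  assumes ded: "dedekind_domain TYPE('a)" and prime: "is_prime_ideal p" and a: "a \<in> p" "a \<noteq> 0"
  obtains b where "p = conductor a b"
proof -
  have ideal: "is_ideal p" and not_UNIV: "p \<noteq> UNIV" using prime by (auto simp: is_prime_ideal_def)
  have "conductor a 1 \<subseteq> p"
    using a ideal_mult_right[OF ideal] by (auto simp: conductor_def elim: dvdE)
  then have "conductor a 1 \<in> {conductor a b | b. conductor a b \<subseteq> p}" by blast
  with dedekind_noetherian[OF ded]
  have "\<exists>M\<in>{conductor a b | b. conductor a b \<subseteq> p}.
      \<forall>J\<in>{conductor a b | b. conductor a b \<subseteq> p}. M \<subseteq> J \<longrightarrow> J = M"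
    by (rule noetherian_maximal_ideal) (auto simp: conductor_def is_ideal_dvd_mult)
  then obtain b where b: "conductor a b \<subseteq> p" and maximal:
    "\<forall>J\<in>{conductor a b | b. conductor a b \<subseteq> p}. conductor a b \<subseteq> J \<longrightarrow> J = conductor a b"
    by auto
  have "is_prime_ideal (conductor a b)"
    using prime b by (rule maximal_conductor_prime) (use maximal in auto)
  moreover have "a \<in> conductor a b" by (simp add: conductor_def)
  ultimately have "is_maximal_ideal (conductor a b)"
    using ded a(2) unfolding dedekind_domain_def by blast
  then have "conductor a b = p"
    using b ideal not_UNIV by (auto simp: is_maximal_ideal_def)
  then show thesis using that by blast
qed

lemma exists_uniformizer:
  fixes p :: "'a::idom set"
  assumes ded: "dedekind_domain TYPE('a)" and prime: "is_prime_ideal p" and nonzero: "p \<noteq> {0}"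
  obtains \<pi> \<tau> where "\<pi> \<in> p" "\<tau> \<notin> p" "\<And>x. x \<in> p \<Longrightarrow> \<pi> dvd \<tau> * x"
proof -
  have ideal: "is_ideal p" and "1 \<notin> p"
    using prime ideal_eq_UNIV_iff by (auto simp: is_prime_ideal_def)
  from nonzero ideal_zero[OF ideal] obtain a where a: "a \<in> p" "a \<noteq> 0" by blast
  obtain b where "p = conductor a b" using prime_ideal_eq_conductor[OF ded prime a] .
  then have b: "p = {x. a dvd b * x}" by (simp add: conductor_def)
  have "\<not> a dvd b" using \<open>1 \<notin> p\<close> by (auto simp: b)
  then obtain \<pi> where \<pi>: "\<pi> \<in> p" "\<And>y. y \<in> p \<Longrightarrow> b * \<pi> \<noteq> a * y"
    using dvd_of_stable_ideal[OF ded a a(2)] by blast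
  then obtain \<tau> where \<tau>: "b * \<pi> = a * \<tau>" unfolding b by (auto elim: dvdE)
  show thesis
  proof (rule that[OF \<pi>(1)])
    show "\<tau> \<notin> p" using \<pi>(2) \<tau> by blast
    fix x assume "x \<in> p"
    then obtain y where "b * x = a * y" unfolding b by (auto elim: dvdE)
    then have "a * (\<tau> * x) = a * (\<pi> * y)" using \<tau> by (metis mult.assoc mult.left_commute)
    then show "\<pi> dvd \<tau> * x" using a(2) by simp
  qed
qed

declare ideal_pow.simps(2) [simp del]

lemma power_mem_ideal_pow: "x \<in> p \<Longrightarrow> x ^ k \<in> ideal_pow p k"
proof (induction k)
  case (Suc k)
  then show ?case
    using ideal_gen_superset[of "{a * b | a b. a \<in> p \<and> b \<in> ideal_pow p k}"]
    by (auto simp: ideal_pow.simps(2))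
qed simp

lemma ideal_pow_antimono:
  assumes "i \<le> j"
  shows "ideal_pow p j \<subseteq> ideal_pow p i"
proof -
  have "ideal_pow p (Suc k) \<subseteq> ideal_pow p k" for k
    unfolding ideal_pow.simps
    by (intro ideal_gen_least is_ideal_ideal_pow)
      (auto intro: ideal_mult_left[OF is_ideal_ideal_pow])
  then show ?thesis using assms by (rule lift_Suc_antimono_le)
qed

lemma ideal_pow_1:
  assumes "is_ideal p"
  shows "ideal_pow p 1 = p"
proof
  show "ideal_pow p 1 \<subseteq> p"
    unfolding One_nat_def ideal_pow.simps using assms
    by (intro ideal_gen_least) (auto intro: ideal_mult_right)
  show "p \<subseteq> ideal_pow p 1" using power_mem_ideal_pow[of _ p 1] by auto
qed

locale dedekind_prime =
  fixes p :: "'a::idom set"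
  assumes dedekind: "dedekind_domain TYPE('a)" and prime: "is_prime_ideal p" and nonzero: "p \<noteq> {0}"
begin

text \<open>\<open>\<pi>\<close> generates \<open>p\<close> in the localization at \<open>p\<close>, with \<open>\<tau> \<notin> p\<close> as a common denominator.\<close>
definition \<pi> :: 'a where
  "\<pi> = (SOME \<pi>. \<pi> \<in> p \<and> (\<exists>\<tau>. \<tau> \<notin> p \<and> (\<forall>x\<in>p. \<pi> dvd \<tau> * x)))"

definition \<tau> :: 'a where
  "\<tau> = (SOME \<tau>. \<tau> \<notin> p \<and> (\<forall>x\<in>p. \<pi> dvd \<tau> * x))"

lemma pi_mem: "\<pi> \<in> p"
  and tau_notin: "\<tau> \<notin> p"
  and pi_dvd: "x \<in> p \<Longrightarrow> \<pi> dvd \<tau> * x"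
proof -
  have "\<exists>\<pi>. \<pi> \<in> p \<and> (\<exists>\<tau>. \<tau> \<notin> p \<and> (\<forall>x\<in>p. \<pi> dvd \<tau> * x))"
    using exists_uniformizer[OF dedekind prime nonzero] by metis
  from someI_ex[OF this, folded \<pi>_def]
  have "\<pi> \<in> p" and ex: "\<exists>\<tau>. \<tau> \<notin> p \<and> (\<forall>x\<in>p. \<pi> dvd \<tau> * x)" by auto
  with someI_ex[OF ex, folded \<tau>_def]
  show "\<pi> \<in> p" "\<tau> \<notin> p" "x \<in> p \<Longrightarrow> \<pi> dvd \<tau> * x" by auto
qed

lemma ideal: "is_ideal p"
  using prime by (simp add: is_prime_ideal_def)

lemma one_notin: "1 \<notin> p"
  using prime ideal_eq_UNIV_iff by (auto simp: is_prime_ideal_def)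

lemma mult_notin: "x \<notin> p \<Longrightarrow> y \<notin> p \<Longrightarrow> x * y \<notin> p"
  using prime by (auto simp: is_prime_ideal_def)

lemma power_notin: "x \<notin> p \<Longrightarrow> x ^ k \<notin> p"
  by (induction k) (auto simp: one_notin mult_notin)

lemma pi_nonzero: "\<pi> \<noteq> 0"
proof
  assume "\<pi> = 0"
  then have "x = 0" if "x \<in> p" for x
    using pi_dvd[OF that] tau_notin ideal_zero[OF ideal] by auto
  then show False using nonzero ideal_zero[OF ideal] by blast
qed

lemma inverse_mod_pow:
  assumes "s \<notin> p"
  obtains r where "1 - s * r \<in> ideal_pow p k"
proof -
  have "is_ideal (p + {x. s dvd x})"
    using is_ideal_plus[OF ideal is_ideal_dvd_mult[of s 1]] by simp
  moreover have "p \<subseteq> p + {x. s dvd x}"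
    using ideal_subset_plus[OF is_ideal_dvd_mult[of s 1]] by simp
  moreover have "s \<in> p + {x. s dvd x}"
    using set_plus_intro[OF ideal_zero[OF ideal], of s "{x. s dvd x}"] by simp
  ultimately have "p + {x. s dvd x} = UNIV"
    using dedekind prime nonzero assms unfolding dedekind_domain_def is_maximal_ideal_def by metis
  then have "1 \<in> p + {x. s dvd x}" by blast
  then obtain z y where z: "z \<in> p" "s dvd y" "1 = z + y" by (auto elim!: set_plus_elim)
  have "1 - z dvd 1 - z ^ k" by (simp add: one_diff_power_eq)
  then have "s dvd 1 - z ^ k" using z(2,3) by (metis add_diff_cancel_left' dvd_trans)
  then obtain r where "1 - z ^ k = s * r" by (elim dvdE)
  then have "1 - s * r = z ^ k" by (simp add: algebra_simps)
  then show thesis using that power_mem_ideal_pow[OF z(1)] by metis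
qed

lemma pi_power_dvd:
  assumes "x \<in> ideal_pow p k"
  shows "\<pi> ^ k dvd \<tau> ^ k * x"
  using assms
proof (induction k arbitrary: x)
  case (Suc k)
  have "{a * b | a b. a \<in> p \<and> b \<in> ideal_pow p k} \<subseteq> {x. \<pi> ^ Suc k dvd \<tau> ^ Suc k * x}"
  proof clarify
    fix a b assume "a \<in> p" "b \<in> ideal_pow p k"
    then have "\<pi> * \<pi> ^ k dvd (\<tau> * a) * (\<tau> ^ k * b)"
      by (intro mult_dvd_mono pi_dvd Suc.IH)
    then show "\<pi> ^ Suc k dvd \<tau> ^ Suc k * (a * b)" by (simp add: ac_simps)
  qed
  then have "ideal_pow p (Suc k) \<subseteq> {x. \<pi> ^ Suc k dvd \<tau> ^ Suc k * x}"
    unfolding ideal_pow.simps by (rule ideal_gen_least[OF _ is_ideal_dvd_mult])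
  with Suc.prems show ?case by blast
qed simp

lemma mem_pow_iff: "x \<in> ideal_pow p k \<longleftrightarrow> (\<exists>s. s \<notin> p \<and> \<pi> ^ k dvd s * x)"
proof
  assume "x \<in> ideal_pow p k"
  then show "\<exists>s. s \<notin> p \<and> \<pi> ^ k dvd s * x"
    using pi_power_dvd power_notin[OF tau_notin] by blast
next
  assume "\<exists>s. s \<notin> p \<and> \<pi> ^ k dvd s * x"
  then obtain s y where s: "s \<notin> p" "s * x = \<pi> ^ k * y" unfolding dvd_def by blast
  obtain r where r: "1 - s * r \<in> ideal_pow p k" using inverse_mod_pow[OF s(1)] .
  have "(1 - s * r) * x + \<pi> ^ k * (r * y) \<in> ideal_pow p k"
    using r power_mem_ideal_pow[OF pi_mem]
    by (intro ideal_add ideal_mult_right is_ideal_ideal_pow)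
  also have "\<pi> ^ k * (r * y) = s * r * x" using s(2) by (metis mult.assoc mult.commute)
  finally show "x \<in> ideal_pow p k" by (simp add: algebra_simps)
qed

text \<open>If \<open>x\<close> lies in all powers of \<open>p\<close>, then \<open>\<tau>\<^sup>k x = \<pi>\<^sup>k y\<^sub>k\<close>, and a linear relation
  \<open>y\<^sub>k\<^sub>+\<^sub>1 = \<Sum>\<^sub>i\<^sub>\<le>\<^sub>k r\<^sub>i y\<^sub>i\<close> makes \<open>\<tau>\<^sup>k\<^sup>+\<^sup>1\<close> a multiple of \<open>\<pi>\<close>.\<close>
lemma krull_intersection:
  assumes "x \<noteq> 0"
  obtains k where "x \<notin> ideal_pow p k"
proof (rule ccontr)
  assume "\<not> thesis"
  with that have "\<pi> ^ k dvd \<tau> ^ k * x" for k using pi_power_dvd by blast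
  then obtain y where y: "\<And>k. \<tau> ^ k * x = \<pi> ^ k * y k" unfolding dvd_def by metis
  obtain k r where r: "y (Suc k) = (\<Sum>i\<le>k. r i * y i)"
    using dedekind_noetherian[OF dedekind] by (rule noetherian_sequenceE)
  have shift: "\<tau> ^ j * y i = \<tau> ^ i * \<pi> ^ (j - i) * y j" if "i \<le> j" for i j
  proof -
    have "\<pi> ^ i * (\<tau> ^ j * y i) = \<tau> ^ i * (\<tau> ^ j * x)" using y[of i] by (simp add: ac_simps)
    also have "\<dots> = \<tau> ^ i * (\<pi> ^ i * \<pi> ^ (j - i) * y j)" using y[of j] that by (simp flip: power_add)
    also have "\<dots> = \<pi> ^ i * (\<tau> ^ i * \<pi> ^ (j - i) * y j)" by (simp only: ac_simps)
    finally show ?thesis using pi_nonzero by simp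
  qed
  have "\<tau> ^ Suc k * y (Suc k) = (\<Sum>i\<le>k. r i * (\<tau> ^ Suc k * y i))"
    unfolding r sum_distrib_left by (simp only: mult.left_commute)
  also have "\<dots> = (\<Sum>i\<le>k. r i * \<tau> ^ i * \<pi> ^ (Suc k - i)) * y (Suc k)"
    unfolding sum_distrib_right
  proof (rule sum.cong[OF refl])
    fix i assume "i \<in> {..k}"
    then show "r i * (\<tau> ^ Suc k * y i) = r i * \<tau> ^ i * \<pi> ^ (Suc k - i) * y (Suc k)"
      using shift[of i "Suc k"] by (simp only: mult.assoc) simp
  qed
  finally have "\<tau> ^ Suc k = (\<Sum>i\<le>k. r i * \<tau> ^ i * \<pi> ^ (Suc k - i))"
    using y[of "Suc k"] assms tau_notin ideal_zero[OF ideal] by (auto simp del: power_Suc)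
  also have "\<pi> dvd \<dots>" by (intro dvd_sum dvd_mult) simp
  finally have "\<tau> ^ Suc k \<in> p" using ideal_mult_right[OF ideal pi_mem] by (auto elim: dvdE)
  then show False using power_notin[OF tau_notin] by blast
qed

definition val :: "'a \<Rightarrow> nat" where
  "val x = (LEAST k. x \<notin> ideal_pow p (Suc k))"

lemma mem_pow_iff_val:
  assumes "x \<noteq> 0"
  shows "x \<in> ideal_pow p k \<longleftrightarrow> k \<le> val x"
proof -
  obtain j where "x \<notin> ideal_pow p j" using krull_intersection[OF assms] .
  then have "x \<notin> ideal_pow p (Suc j)" using ideal_pow_antimono[of j "Suc j"] by auto
  then have not_Suc: "x \<notin> ideal_pow p (Suc (val x))" unfolding val_def by (rule LeastI)
  have "x \<in> ideal_pow p (val x)"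
  proof (cases "val x")
    case (Suc k)
    then show ?thesis
      using not_less_Least[of k "\<lambda>k. x \<notin> ideal_pow p (Suc k)"] by (auto simp: val_def)
  qed simp
  then show ?thesis
    using not_Suc ideal_pow_antimono by (metis not_less_eq_eq subsetD)
qed

lemma unit_part:
  assumes "a \<noteq> 0"
  obtains y where "y \<notin> p" "\<tau> ^ val a * a = \<pi> ^ val a * y"
proof -
  have "\<pi> ^ val a dvd \<tau> ^ val a * a"
    using assms by (intro pi_power_dvd) (simp add: mem_pow_iff_val)
  then obtain y where y: "\<tau> ^ val a * a = \<pi> ^ val a * y" by (elim dvdE)
  have "y \<notin> p"
  proof
    assume "y \<in> p"
    then have "\<pi> ^ val a * \<pi> dvd \<pi> ^ val a * (\<tau> * y)" by (intro mult_dvd_mono pi_dvd) auto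
    also have "\<dots> = \<tau> ^ Suc (val a) * a" using y by (simp add: ac_simps)
    finally have "a \<in> ideal_pow p (Suc (val a))"
      unfolding mem_pow_iff using power_notin[OF tau_notin, of "Suc (val a)"]
      by (auto simp: mult.commute)
    then show False using assms by (simp add: mem_pow_iff_val)
  qed
  with y show thesis using that by blast
qed

lemma pow_cancel:
  assumes "a \<noteq> 0" and ax: "a * x \<in> ideal_pow p (val a + m)"
  shows "x \<in> ideal_pow p m"
proof -
  obtain y where y: "y \<notin> p" "\<tau> ^ val a * a = \<pi> ^ val a * y" using unit_part[OF assms(1)] .
  obtain s where s: "s \<notin> p" "\<pi> ^ (val a + m) dvd s * (a * x)"
    using ax unfolding mem_pow_iff by blast
  then have "\<pi> ^ val a * \<pi> ^ m dvd \<tau> ^ val a * (s * (a * x))" by (simp add: power_add)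
  also have "\<tau> ^ val a * (s * (a * x)) = \<pi> ^ val a * ((s * y) * x)"
    using y(2) by (metis mult.assoc mult.left_commute)
  finally have "\<pi> ^ m dvd (s * y) * x" using pi_nonzero by simp
  then show ?thesis unfolding mem_pow_iff using mult_notin s(1) y(1) by blast
qed

lemma pow_divide:
  assumes "d \<noteq> 0" and x: "x \<in> ideal_pow p (val d)"
  obtains y where "x - d * y \<in> ideal_pow p (m + val d)"
proof -
  obtain z where z: "z \<notin> p" "\<tau> ^ val d * d = \<pi> ^ val d * z" using unit_part[OF assms(1)] .
  obtain y where y: "\<tau> ^ val d * x = \<pi> ^ val d * y" using pi_power_dvd[OF x] by (elim dvdE)
  obtain r where "1 - z * r \<in> ideal_pow p m" using inverse_mod_pow[OF z(1)] .
  then obtain s e where s: "s \<notin> p" "s * (1 - z * r) = \<pi> ^ m * e"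
    unfolding mem_pow_iff dvd_def by blast
  have "(s * \<tau> ^ val d) * (x - d * (r * y)) = s * (\<tau> ^ val d * x) - s * (\<tau> ^ val d * d) * r * y"
    by (simp add: algebra_simps)
  also have "\<dots> = \<pi> ^ val d * (s * (1 - z * r)) * y"
    unfolding y z(2) by (simp add: algebra_simps)
  also have "\<dots> = \<pi> ^ (m + val d) * (e * y)"
    unfolding s(2) by (simp add: power_add ac_simps)
  finally have "x - d * (r * y) \<in> ideal_pow p (m + val d)"
    unfolding mem_pow_iff using mult_notin[OF s(1) power_notin[OF tau_notin]]
    by (metis dvd_triv_left)
  then show thesis by (rule that)
qed

lemma val_pi_power: "val (\<pi> ^ k) = k"
proof -
  have "\<pi> ^ k \<notin> ideal_pow p (Suc k)"
  proof
    assume "\<pi> ^ k \<in> ideal_pow p (Suc k)"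
    then obtain s where "s \<notin> p" "\<pi> ^ k * \<pi> dvd \<pi> ^ k * s"
      unfolding mem_pow_iff by (auto simp: mult.commute)
    then show False
      using pi_nonzero ideal_mult_right[OF ideal pi_mem] by (auto elim: dvdE)
  qed
  then show ?thesis
    using power_mem_ideal_pow[OF pi_mem, of k] pi_nonzero
    by (simp add: mem_pow_iff_val)
qed

lemma pow_nonzero: "ideal_pow p k \<noteq> {0}"
  using power_mem_ideal_pow[OF pi_mem, of k] power_not_zero[OF pi_nonzero, of k]
  by (metis singletonD)

end


section \<open>Linear relations over integral domains\<close>

lemma exists_linear_relation:
  fixes v :: "'s \<Rightarrow> 'c \<Rightarrow> 'a::idom"
  assumes "finite C" "finite S" "card C < card S"
  shows "\<exists>x. (\<exists>s\<in>S. x s \<noteq> 0) \<and> (\<forall>c\<in>C. (\<Sum>s\<in>S. x s * v s c) = 0)"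
  using assms
proof (induction C arbitrary: S v rule: finite_induct)
  case empty
  then have "S \<noteq> {}" by auto
  then show ?case by (auto intro!: exI[of _ "\<lambda>_. 1"])
next
  case (insert c C)
  show ?case
  proof (cases "\<forall>s\<in>S. v s c = 0")
    case True
    have "card C < card S" using insert by simp
    from insert.IH[OF insert.prems(1) this, of v] True show ?thesis by auto
  next
    case False
    then obtain pivot where pivot: "pivot \<in> S" "v pivot c \<noteq> 0" by blast
    define S' where "S' = S - {pivot}"
    define v' where "v' s d = v pivot c * v s d - v s c * v pivot d" for s d
    have "finite S'" "card C < card S'" using insert pivot by (auto simp: S'_def)
    then obtain x where x: "\<exists>s\<in>S'. x s \<noteq> 0" "\<And>d. d \<in> C \<Longrightarrow> (\<Sum>s\<in>S'. x s * v' s d) = 0"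
      using insert.IH[of S' v'] by blast
    define y where "y s = (if s = pivot then - (\<Sum>s\<in>S'. x s * v s c) else x s * v pivot c)" for s
    have y: "(\<Sum>s\<in>S. y s * v s d) = (\<Sum>s\<in>S'. x s * v' s d)" for d
    proof -
      have "(\<Sum>s\<in>S. y s * v s d) = y pivot * v pivot d + (\<Sum>s\<in>S'. y s * v s d)"
        unfolding S'_def using pivot insert.prems by (intro sum.remove) auto
      also have "(\<Sum>s\<in>S'. y s * v s d) = (\<Sum>s\<in>S'. x s * (v pivot c * v s d))"
        by (rule sum.cong) (auto simp: y_def S'_def)
      also have "y pivot * v pivot d = - (\<Sum>s\<in>S'. x s * (v s c * v pivot d))"
        by (simp add: y_def sum_distrib_right mult.assoc)
      finally show ?thesis by (simp add: v'_def right_diff_distrib sum_subtractf)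
    qed
    have "(\<Sum>s\<in>S. y s * v s d) = 0" if "d \<in> insert c C" for d
      using that x(2) by (auto simp: y v'_def mult.commute)
    moreover have "\<exists>s\<in>S. y s \<noteq> 0" using x(1) pivot(2) by (auto simp: y_def S'_def)
    ultimately show ?thesis by blast
  qed
qed

text \<open>The vectors on \<open>A\<close> in the span of the \<open>v c\<close>, \<open>c \<in> C\<close>, over the fraction field, described
  by the linear forms that vanish on this span.\<close>
definition fraction_span :: "'i set \<Rightarrow> 'c set \<Rightarrow> ('c \<Rightarrow> 'i \<Rightarrow> 'a) \<Rightarrow> ('i \<Rightarrow> 'a::comm_ring_1) set" where
  "fraction_span A C v =
     {X. \<forall>F. (\<forall>c\<in>C. (\<Sum>i\<in>A. F i * v c i) = 0) \<longrightarrow> (\<Sum>i\<in>A. F i * X i) = 0}"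

lemma fraction_span_cong:
  assumes "\<And>i. i \<in> A \<Longrightarrow> X i = X' i" "\<And>c i. c \<in> C \<Longrightarrow> i \<in> A \<Longrightarrow> v c i = v' c i"
  shows "X \<in> fraction_span A C v \<longleftrightarrow> X' \<in> fraction_span A C v'"
  unfolding fraction_span_def using assms by (simp cong: sum.cong)

lemma maximal_independent_coordinates:
  fixes v :: "'c \<Rightarrow> 'i \<Rightarrow> 'a::idom"
  assumes fin: "finite A" "finite C"
  obtains R where "R \<subseteq> A" "card R \<le> card C"
    "\<forall>i\<in>A - R. \<exists>F. F i \<noteq> 0 \<and> (\<forall>c\<in>C. (\<Sum>j\<in>insert i R. F j * v c j) = 0)"
proof -
  define dep where "dep R \<longleftrightarrow>
    (\<exists>x. (\<exists>i\<in>R. x i \<noteq> 0) \<and> (\<forall>c\<in>C. (\<Sum>i\<in>R. x i * v c i) = 0))" for R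
  have "\<exists>R. (R \<subseteq> A \<and> \<not> dep R) \<and> (\<forall>R'. R' \<subseteq> A \<and> \<not> dep R' \<longrightarrow> card R' \<le> card R)"
  proof (rule ex_has_greatest_nat)
    show "{} \<subseteq> A \<and> \<not> dep {}" by (simp add: dep_def)
    show "\<forall>R. R \<subseteq> A \<and> \<not> dep R \<longrightarrow> card R < Suc (card A)"
      using fin(1) by (auto simp: less_Suc_eq_le intro: card_mono)
  qed
  then obtain R where R: "R \<subseteq> A" "\<not> dep R" "\<And>R'. R' \<subseteq> A \<Longrightarrow> \<not> dep R' \<Longrightarrow> card R' \<le> card R"
    by blast
  have finR: "finite R" using R(1) fin(1) finite_subset by blast
  have "card R \<le> card C"
    using exists_linear_relation[OF fin(2) finR, of "\<lambda>i c. v c i"] R(2)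
    unfolding dep_def by (meson not_le)
  moreover have "\<exists>F. F i \<noteq> 0 \<and> (\<forall>c\<in>C. (\<Sum>j\<in>insert i R. F j * v c j) = 0)" if i: "i \<in> A - R" for i
  proof -
    have "dep (insert i R)" using R(3)[of "insert i R"] R(1) finR i by force
    then obtain F where F: "\<exists>j\<in>insert i R. F j \<noteq> 0" "\<forall>c\<in>C. (\<Sum>j\<in>insert i R. F j * v c j) = 0"
      unfolding dep_def by blast
    have "F i \<noteq> 0"
    proof
      assume "F i = 0"
      then have "\<exists>j\<in>R. F j \<noteq> 0" "\<forall>c\<in>C. (\<Sum>j\<in>R. F j * v c j) = 0" using F finR i by auto
      with R(2) show False unfolding dep_def by blast
    qed
    with F(2) show ?thesis by blast
  qed
  ultimately show thesis using R(1) that by blast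
qed

lemma fraction_span_determined:
  fixes v :: "'c \<Rightarrow> 'i \<Rightarrow> 'a::idom"
  assumes fin: "finite A" "finite C"
  obtains R F where "R \<subseteq> A" "card R \<le> card C" "\<forall>i\<in>A - R. F i i \<noteq> 0 \<and>
    (\<forall>X\<in>fraction_span A C v. F i i * X i = - (\<Sum>r\<in>R. F i r * X r))"
proof -
  obtain R where R: "R \<subseteq> A" "card R \<le> card C"
    "\<forall>i\<in>A - R. \<exists>F. F i \<noteq> 0 \<and> (\<forall>c\<in>C. (\<Sum>j\<in>insert i R. F j * v c j) = 0)"
    using fin by (rule maximal_independent_coordinates)
  then obtain F where F: "\<And>i. i \<in> A - R \<Longrightarrow> F i i \<noteq> 0"
    "\<And>i c. i \<in> A - R \<Longrightarrow> c \<in> C \<Longrightarrow> (\<Sum>j\<in>insert i R. F i j * v c j) = 0"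
    by metis
  have "F i i * X i = - (\<Sum>r\<in>R. F i r * X r)"
    if i: "i \<in> A - R" and X: "X \<in> fraction_span A C v" for i X
  proof -
    define F' where "F' j = (if j \<in> insert i R then F i j else 0)" for j
    have F': "(\<Sum>j\<in>A. F' j * Y j) = (\<Sum>j\<in>insert i R. F i j * Y j)" for Y
      using fin(1) R(1) i by (intro sum.mono_neutral_cong_right) (auto simp: F'_def)
    then have "\<forall>c\<in>C. (\<Sum>j\<in>A. F' j * v c j) = 0" using F(2)[OF i] by simp
    then have "(\<Sum>j\<in>A. F' j * X j) = 0" using X unfolding fraction_span_def by blast
    moreover have "finite R" using R(1) fin(1) by (rule finite_subset)
    ultimately show ?thesis using F' i by (simp add: eq_neg_iff_add_eq_0)
  qed
  with R(1,2) F(1) show thesis using that by blast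
qed


section \<open>Random vectors with independent coordinates\<close>

lemma prob_bind_pmf_le:
  assumes "\<And>x. x \<in> G \<Longrightarrow> measure_pmf.prob (f x) E \<le> c"
    and "\<And>x. x \<notin> G \<Longrightarrow> measure_pmf.prob (f x) E = 0" and c: "0 \<le> c"
  shows "measure_pmf.prob (bind_pmf M f) E \<le> c * measure_pmf.prob M G"
proof -
  have "emeasure (measure_pmf (bind_pmf M f)) E
    = (\<integral>\<^sup>+x. emeasure (measure_pmf (f x)) E \<partial>measure_pmf M)"
    by simp
  also have "\<dots> \<le> (\<integral>\<^sup>+x. ennreal c * indicator G x \<partial>measure_pmf M)"
    using assms by (intro nn_integral_mono)
      (auto simp: measure_pmf.emeasure_eq_measure indicator_def intro!: ennreal_leI)
  also have "\<dots> = ennreal (c * measure_pmf.prob M G)"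
    using c by (simp add: nn_integral_cmult measure_pmf.emeasure_eq_measure ennreal_mult)
  finally show ?thesis
    using c by (simp add: measure_pmf.emeasure_eq_measure)
qed

lemma prob_Pi_pmf_conditional_le:
  assumes "finite S" "A \<subseteq> S" "0 \<le> c"
    and conditional: "\<And>Y. measure_pmf.prob (Pi_pmf A d \<mu>)
      {X. (\<lambda>i. if i \<in> A then X i else Y i) \<in> E} \<le> c"
  shows "measure_pmf.prob (Pi_pmf S d \<mu>) E \<le> c"
proof -
  define B where "B = S - A"
  have S: "S = A \<union> B" "finite A" "finite B" "A \<inter> B = {}"
    using assms(1,2) finite_subset by (auto simp: B_def)
  have "Pi_pmf S d \<mu> =
    bind_pmf (Pi_pmf B d \<mu>) (\<lambda>Y. map_pmf (\<lambda>X i. if i \<in> A then X i else Y i) (Pi_pmf A d \<mu>))"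
    unfolding S(1) Pi_pmf_union[OF S(2-4)] pair_pmf_def map_pmf_def
    by (subst bind_commute_pmf) (simp add: bind_assoc_pmf bind_return_pmf)
  also have "measure_pmf.prob \<dots> E \<le> c * measure_pmf.prob (Pi_pmf B d \<mu>) UNIV"
    using conditional \<open>0 \<le> c\<close> by (intro prob_bind_pmf_le) (auto simp: vimage_def)
  finally show ?thesis by simp
qed

lemma map_pmf_Pi_pmf_reindex:
  assumes "finite I" "inj_on g I"
  shows "map_pmf (\<lambda>X i. if i \<in> I then X (g i) else d) (Pi_pmf (g ` I) d \<mu>)
    = Pi_pmf I d (\<lambda>i. \<mu> (g i))"
  using assms
proof (induction I rule: finite_induct)
  case (insert i I)
  have g: "g i \<notin> g ` I" using insert by auto
  have restrict: "(\<lambda>j. if j \<in> insert i I then (X(g i := y)) (g j) else d)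
      = (\<lambda>j. if j \<in> I then X (g j) else d)(i := y)" for X y
    using g by (auto simp: fun_eq_iff) (metis imageI)
  have "Pi_pmf (insert i I) d (\<lambda>i. \<mu> (g i)) = map_pmf (\<lambda>(y, X). X(i := y))
      (pair_pmf (\<mu> (g i)) (map_pmf (\<lambda>X j. if j \<in> I then X (g j) else d) (Pi_pmf (g ` I) d \<mu>)))"
    using insert by (simp add: Pi_pmf_insert)
  also have "\<dots> = map_pmf (\<lambda>X j. if j \<in> insert i I then X (g j) else d)
      (map_pmf (\<lambda>(y, X). X(g i := y)) (pair_pmf (\<mu> (g i)) (Pi_pmf (g ` I) d \<mu>)))"
    unfolding pair_map_pmf2 map_pmf_comp
    by (intro map_pmf_cong refl) (auto simp: restrict simp del: fun_upd_apply insert_iff)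
  also have "map_pmf (\<lambda>(y, X). X(g i := y)) (pair_pmf (\<mu> (g i)) (Pi_pmf (g ` I) d \<mu>))
      = Pi_pmf (g ` insert i I) d \<mu>"
    using insert(1) g by (simp add: Pi_pmf_insert)
  finally show ?case ..
qed simp

lemma prob_slice_le:
  fixes Q :: "('i \<Rightarrow> 'a) \<Rightarrow> ('z \<Rightarrow> 'a) \<Rightarrow> bool"
  assumes "finite S" and g: "inj_on g I" "g ` I \<subseteq> S" and "0 \<le> c"
    and local: "\<And>X X' M M'. Q X M \<Longrightarrow> \<forall>i\<in>I. X i = X' i \<Longrightarrow> \<forall>z. z \<notin> g ` I \<longrightarrow> M z = M' z \<Longrightarrow> Q X' M'"
    and slice: "\<And>M. measure_pmf.prob (Pi_pmf I d (\<lambda>i. \<mu> (g i))) {X. Q X M} \<le> c"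
  shows "measure_pmf.prob (Pi_pmf S d \<mu>) {M. Q (\<lambda>i. M (g i)) M} \<le> c"
proof (rule prob_Pi_pmf_conditional_le[where A = "g ` I"])
  fix Y
  define glue where "glue X z = (if z \<in> g ` I then X z else Y z)" for X :: "'z \<Rightarrow> 'a" and z
  have "finite I" using assms(1) g finite_subset finite_imageD by blast
  have "measure_pmf.prob (Pi_pmf (g ` I) d \<mu>) {X. Q (\<lambda>i. glue X (g i)) (glue X)}
    \<le> measure_pmf.prob (Pi_pmf (g ` I) d \<mu>) {X. Q (\<lambda>i. if i \<in> I then X (g i) else d) Y}"
    using local[of "\<lambda>i. glue X (g i)" "glue X" "\<lambda>i. if i \<in> I then X (g i) else d" Y for X]
    by (intro measure_pmf.finite_measure_mono) (auto simp: glue_def)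
  also have "\<dots> = measure_pmf.prob (Pi_pmf I d (\<lambda>i. \<mu> (g i))) {X. Q X Y}"
    using \<open>finite I\<close> g(1) by (simp add: vimage_def flip: map_pmf_Pi_pmf_reindex)
  also have "\<dots> \<le> c" by (rule slice)
  finally show "measure_pmf.prob (Pi_pmf (g ` I) d \<mu>)
      {X. (\<lambda>z. if z \<in> g ` I then X z else Y z) \<in> {M. Q (\<lambda>i. M (g i)) M}} \<le> c"
    by (simp add: glue_def[abs_def])
qed (use assms in auto)

lemma prob_linear_form_subset_le:
  fixes a :: "'i \<Rightarrow> 'a::comm_ring_1"
  assumes "finite A" "B \<subseteq> A" "0 \<le> c"
    and bound: "\<And>x. measure_pmf.prob (Pi_pmf B d \<mu>) {X. (\<Sum>i\<in>B. a i * X i) = x} \<le> c"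
  shows "measure_pmf.prob (Pi_pmf A d \<mu>) {X. (\<Sum>i\<in>A. a i * X i) = x} \<le> c"
proof (rule prob_Pi_pmf_conditional_le[where A = B])
  fix Y
  have "(\<Sum>i\<in>A. a i * (if i \<in> B then X i else Y i))
    = (\<Sum>i\<in>B. a i * X i) + (\<Sum>i\<in>A - B. a i * Y i)" for X
    using sum.subset_diff[OF assms(2,1), of "\<lambda>i. a i * (if i \<in> B then X i else Y i)"]
    by (simp add: add.commute)
  then have "{X. (\<lambda>i. if i \<in> B then X i else Y i) \<in> {X. (\<Sum>i\<in>A. a i * X i) = x}}
    = {X. (\<Sum>i\<in>B. a i * X i) = x - (\<Sum>i\<in>A - B. a i * Y i)}"
    by (auto simp: eq_diff_eq)
  then show "measure_pmf.prob (Pi_pmf B d \<mu>)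
    {X. (\<lambda>i. if i \<in> B then X i else Y i) \<in> {X. (\<Sum>i\<in>A. a i * X i) = x}} \<le> c"
    using bound by simp
qed (use assms in auto)

lemma prob_linear_equation_le:
  fixes a b :: "'a::idom"
  assumes "\<And>x. pmf \<nu> x \<le> q" "a \<noteq> 0" "0 \<le> q"
  shows "measure_pmf.prob \<nu> {x. a * x = b} \<le> q"
proof (cases "\<exists>z. a * z = b")
  case True
  then obtain z where z: "a * z = b" by blast
  then have "{x. a * x = b} = {z}" using assms(2) by auto
  then show ?thesis using assms(1) by (simp add: measure_pmf_single)
qed (use assms in simp)

text \<open>Odlyzko: all but \<open>card C\<close> of the coordinates of a vector in the span are determined by the
  others.\<close>
lemma prob_fraction_span_le:
  fixes v :: "'c \<Rightarrow> 'i \<Rightarrow> 'a::idom"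
  assumes fin: "finite A" "finite C" and q: "0 \<le> q" "q \<le> 1"
    and atoms: "\<And>i x. i \<in> A \<Longrightarrow> pmf (\<mu> i) x \<le> q"
  shows "measure_pmf.prob (Pi_pmf A d \<mu>) (fraction_span A C v) \<le> q ^ (card A - card C)"
proof -
  obtain R F where R: "R \<subseteq> A" "card R \<le> card C" and F: "\<forall>i\<in>A - R. F i i \<noteq> 0 \<and>
    (\<forall>X\<in>fraction_span A C v. F i i * X i = - (\<Sum>r\<in>R. F i r * X r))"
    using fraction_span_determined[OF fin, of v] .
  show ?thesis
  proof (rule prob_Pi_pmf_conditional_le[where A = "A - R"])
    fix Y
    define glue where "glue X i = (if i \<in> A - R then X i else Y i)" for X :: "'i \<Rightarrow> 'a" and i
    have "F i i * X i = - (\<Sum>r\<in>R. F i r * Y r)"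
      if "glue X \<in> fraction_span A C v" "i \<in> A - R" for X :: "'i \<Rightarrow> 'a" and i
    proof -
      have "F i i * glue X i = - (\<Sum>r\<in>R. F i r * glue X r)" using F that by blast
      then show ?thesis using that(2) by (simp add: glue_def cong: sum.cong)
    qed
    then have "measure_pmf.prob (Pi_pmf (A - R) d \<mu>) {X. glue X \<in> fraction_span A C v}
      \<le> measure_pmf.prob (Pi_pmf (A - R) d \<mu>)
          (Pi (A - R) (\<lambda>i. {x. F i i * x = - (\<Sum>r\<in>R. F i r * Y r)}))"
      by (intro measure_pmf.finite_measure_mono) auto
    also have "\<dots> = (\<Prod>i\<in>A - R. measure_pmf.prob (\<mu> i) {x. F i i * x = - (\<Sum>r\<in>R. F i r * Y r)})"
      using fin by (intro measure_Pi_pmf_Pi) auto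
    also have "\<dots> \<le> (\<Prod>i\<in>A - R. q)"
      using F atoms q by (intro prod_mono conjI prob_linear_equation_le) auto
    also have "\<dots> = q ^ (card A - card R)"
      using R(1) fin(1) by (simp add: card_Diff_subset finite_subset)
    also have "\<dots> \<le> q ^ (card A - card C)"
      using R(2) q by (intro power_decreasing) auto
    finally show "measure_pmf.prob (Pi_pmf (A - R) d \<mu>)
        {X. (\<lambda>i. if i \<in> A - R then X i else Y i) \<in> fraction_span A C v} \<le> q ^ (card A - card C)"
      by (simp add: glue_def[abs_def])
  qed (use fin q in auto)
qed


section \<open>Equidistribution in finite quotients\<close>

lemma add_subgroup_zero: "add_subgroup W \<Longrightarrow> 0 \<in> W"
  and add_subgroup_add: "add_subgroup W \<Longrightarrow> x \<in> W \<Longrightarrow> y \<in> W \<Longrightarrow> x + y \<in> W"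
  and add_subgroup_minus: "add_subgroup W \<Longrightarrow> x \<in> W \<Longrightarrow> - x \<in> W"
  by (auto simp: add_subgroup_def)

lemma add_subgroup_diff: "add_subgroup W \<Longrightarrow> x \<in> W \<Longrightarrow> y \<in> W \<Longrightarrow> x - y \<in> W"
  using add_subgroup_add[of W x "- y"] add_subgroup_minus[of W y] by simp

lemma ideal_add_subgroup: "is_ideal I \<Longrightarrow> add_subgroup I"
  by (simp add: is_ideal_def add_subgroup_def)

lemma add_subgroup_stabilizer: "add_subgroup {g. \<forall>x. x + g \<in> A \<longleftrightarrow> x \<in> A}"
  unfolding add_subgroup_def
proof (intro conjI ballI)
  fix g h assume "g \<in> {g. \<forall>x. x + g \<in> A \<longleftrightarrow> x \<in> A}" "h \<in> {g. \<forall>x. x + g \<in> A \<longleftrightarrow> x \<in> A}"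
  then show "g + h \<in> {g. \<forall>x. x + g \<in> A \<longleftrightarrow> x \<in> A}" by (simp flip: add.assoc)
next
  fix g assume g: "g \<in> {g. \<forall>x. x + g \<in> A \<longleftrightarrow> x \<in> A}"
  have "x + - g \<in> A \<longleftrightarrow> x \<in> A" for x
  proof -
    have "(x + - g) + g \<in> A \<longleftrightarrow> x + - g \<in> A" using g by blast
    then show ?thesis by simp
  qed
  then show "- g \<in> {g. \<forall>x. x + g \<in> A \<longleftrightarrow> x \<in> A}" by simp
qed simp

definition residue_class :: "'a::ab_group_add set \<Rightarrow> 'a \<Rightarrow> 'a set" where
  "residue_class J x = {y. y - x \<in> J}"

lemma mem_residue_class_self: "add_subgroup J \<Longrightarrow> x \<in> residue_class J x"
  by (simp add: residue_class_def add_subgroup_zero)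

lemma residue_class_eq_iff:
  assumes "add_subgroup J"
  shows "residue_class J x = residue_class J y \<longleftrightarrow> x - y \<in> J"
proof
  assume "residue_class J x = residue_class J y"
  moreover have "x \<in> residue_class J x" using assms by (rule mem_residue_class_self)
  ultimately show "x - y \<in> J" by (simp add: residue_class_def)
next
  assume "x - y \<in> J"
  then have "z - x \<in> J \<longleftrightarrow> z - y \<in> J" for z
    using add_subgroup_add[OF assms, of "z - x" "x - y"]
      add_subgroup_diff[OF assms, of "z - y" "x - y"]
    by auto
  then show "residue_class J x = residue_class J y" by (simp add: residue_class_def)
qed

lemma quot_eq_range: "add_subgroup J \<Longrightarrow> quot J = range (residue_class J)"
proof -
  assume J: "add_subgroup J"
  have "ideal_rel J `` {x} = residue_class J x" for x
    using add_subgroup_minus[OF J, of "x - y" for y] add_subgroup_minus[OF J, of "y - x" for y]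
    by (auto simp: ideal_rel_def residue_class_def)
  then show ?thesis by (auto simp: quot_def quotient_def)
qed

lemma translate_residue_class: "(+) b ` residue_class J x = residue_class J (b + x)"
proof
  show "residue_class J (b + x) \<subseteq> (+) b ` residue_class J x"
  proof
    fix y assume "y \<in> residue_class J (b + x)"
    then have "y = b + (y - b)" "y - b \<in> residue_class J x"
      by (auto simp: residue_class_def algebra_simps)
    then show "y \<in> (+) b ` residue_class J x" by blast
  qed
qed (auto simp: residue_class_def)

locale finite_index_subgroup =
  fixes J :: "'a::comm_ring_1 set"
  assumes subgroup: "add_subgroup J" and finite_quot: "finite (quot J)"
begin

lemma residue_class_in_quot: "residue_class J x \<in> quot J"
  by (simp add: quot_eq_range[OF subgroup])

lemma quot_eq_residue_class:
  assumes "C \<in> quot J" "x \<in> C"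
  shows "C = residue_class J x"
proof -
  from assms obtain y where "C = residue_class J y" "x - y \<in> J"
    by (auto simp: quot_eq_range[OF subgroup] residue_class_def)
  then show ?thesis using residue_class_eq_iff[OF subgroup, of x y] by simp
qed

lemma disjoint_family_quot: "disjoint_family_on (\<lambda>C. {t. g t \<in> C}) (quot J)"
  unfolding disjoint_family_on_def using quot_eq_residue_class by blast

lemma card_quot_pos: "0 < card (quot J)"
  using finite_quot residue_class_in_quot by (auto simp: card_gt_0_iff)

definition affinely_spanning :: "'a set \<Rightarrow> bool" where
  "affinely_spanning B \<longleftrightarrow> B \<noteq> {} \<and>
     (\<forall>W a. add_subgroup W \<and> J \<subseteq> W \<and> W \<noteq> UNIV \<longrightarrow> \<not> B \<subseteq> residue_class W a)"

lemma translate_class_mem_iff: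
  assumes "b \<in> B" and few: "card (residue_class J ` (B + A)) \<le> card (residue_class J ` A)"
  shows "residue_class J (b + x) \<in> residue_class J ` (B + A)
    \<longleftrightarrow> residue_class J x \<in> residue_class J ` A"
proof -
  let ?cls = "residue_class J"
  have inj: "inj ((`) ((+) b))" by (auto intro!: injI simp: inj_image_eq_iff)
  have card_translate: "card ((`) ((+) b) ` ?cls ` A) = card (?cls ` A)"
    by (rule card_image[OF inj_on_subset[OF inj subset_UNIV]])
  have "(`) ((+) b) ` ?cls ` A = ?cls ` (B + A)"
  proof (rule card_seteq)
    show "finite (?cls ` (B + A))"
      using finite_quot residue_class_in_quot by (blast intro: finite_subset)
    show "(`) ((+) b) ` ?cls ` A \<subseteq> ?cls ` (B + A)"
      using \<open>b \<in> B\<close> by (auto simp: image_image translate_residue_class)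
    show "card (?cls ` (B + A)) \<le> card ((`) ((+) b) ` ?cls ` A)"
      unfolding card_translate by (rule few)
  qed
  then show ?thesis
    unfolding translate_residue_class[symmetric] using inj_image_mem_iff[OF inj] by metis
qed

text \<open>If all translates of \<open>A\<close> by elements of \<open>B\<close> meet the same classes, then \<open>B - B\<close> lies in the
  stabilizer of the union of the classes of \<open>A\<close>.\<close>
lemma card_classes_sumset:
  assumes A: "A \<noteq> {}" and B: "affinely_spanning B"
  shows "min (card (quot J)) (Suc (card (residue_class J ` A))) \<le> card (residue_class J ` (B + A))"
proof (rule ccontr)
  let ?cls = "residue_class J"
  assume "\<not> ?thesis"
  then have few: "card (?cls ` (B + A)) < card (quot J)" "card (?cls ` (B + A)) \<le> card (?cls ` A)"
    by auto
  note translate_mem = translate_class_mem_iff[OF _ few(2)]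
  obtain b0 where b0: "b0 \<in> B" using B by (auto simp: affinely_spanning_def)
  define S where "S = {x. ?cls x \<in> ?cls ` A}"
  define W where "W = {g. \<forall>x. x + g \<in> S \<longleftrightarrow> x \<in> S}"
  have "add_subgroup W" unfolding W_def by (rule add_subgroup_stabilizer)
  moreover have "J \<subseteq> W"
  proof
    fix g assume "g \<in> J"
    then have "?cls (x + g) = ?cls x" for x by (simp add: residue_class_eq_iff[OF subgroup])
    then show "g \<in> W" by (simp add: W_def S_def)
  qed
  moreover have "W \<noteq> UNIV"
  proof -
    obtain a where a: "a \<in> S" using A by (auto simp: S_def)
    have "?cls ` (B + A) \<noteq> range ?cls" using few(1) by (auto simp: quot_eq_range[OF subgroup])
    then obtain z where "?cls z \<notin> ?cls ` (B + A)" by blast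
    then have "z - b0 \<notin> S" using translate_mem[OF b0, of "z - b0"] by (simp add: S_def)
    then have "z - b0 - a \<notin> W" using a by (auto simp: W_def intro!: exI[of _ a])
    then show ?thesis by blast
  qed
  moreover have "B \<subseteq> residue_class W b0"
  proof
    fix b assume b: "b \<in> B"
    have "x + (b - b0) \<in> S \<longleftrightarrow> x \<in> S" for x
      using translate_mem[OF b0, of "x + (b - b0)"] translate_mem[OF b, of x]
      by (simp add: S_def add.commute)
    then show "b \<in> residue_class W b0" by (simp add: residue_class_def W_def)
  qed
  ultimately show False using B unfolding affinely_spanning_def by blast
qed

lemma card_classes_sum:
  assumes "finite I" "\<And>i. i \<in> I \<Longrightarrow> affinely_spanning (B i)"
  shows "min (card (quot J)) (Suc (card I)) \<le> card (residue_class J ` (\<Sum>i\<in>I. B i))"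
  using assms
proof (induction I rule: finite_induct)
  case (insert i I)
  then have IH: "min (card (quot J)) (Suc (card I)) \<le> card (residue_class J ` (\<Sum>i\<in>I. B i))" by simp
  then have "(\<Sum>i\<in>I. B i) \<noteq> {}" using card_quot_pos by (intro notI) simp
  then have "min (card (quot J)) (Suc (card (residue_class J ` (\<Sum>i\<in>I. B i))))
      \<le> card (residue_class J ` (B i + (\<Sum>i\<in>I. B i)))"
    using insert by (intro card_classes_sumset) auto
  with IH show ?case using insert(1,2) by auto
qed simp

lemma exists_sum_in_class:
  assumes I: "finite I" "card (quot J) \<le> card I" and B: "\<And>i. i \<in> I \<Longrightarrow> affinely_spanning (B i)"
  obtains b where "\<And>i. i \<in> I \<Longrightarrow> b i \<in> B i" "(\<Sum>i\<in>I. b i) \<in> residue_class J z"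
proof -
  have "card (quot J) \<le> card (residue_class J ` (\<Sum>i\<in>I. B i))"
    using card_classes_sum[OF I(1) B] I(2) by simp
  then have "residue_class J ` (\<Sum>i\<in>I. B i) = quot J"
    using finite_quot residue_class_in_quot by (intro card_seteq) auto
  then obtain s where s: "s \<in> (\<Sum>i\<in>I. B i)" "residue_class J s = residue_class J z"
    using residue_class_in_quot[of z] by (metis imageE)
  then obtain b where b: "s = sum b I" "\<forall>i\<in>I. b i \<in> B i" by (auto simp: set_sum_alt[OF I(1)])
  have "(\<Sum>i\<in>I. b i) \<in> residue_class J z"
    using s(2) b(1) residue_class_eq_iff[OF subgroup, of s z] by (simp add: residue_class_def)
  with b(2) show thesis using that by blast
qed

lemma sum_prob_quot: "(\<Sum>C\<in>quot J. measure_pmf.prob \<nu> {t. g t \<in> C}) = 1"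
proof -
  have "(\<Sum>C\<in>quot J. measure_pmf.prob \<nu> {t. g t \<in> C}) = measure_pmf.prob \<nu> (\<Union>C\<in>quot J. {t. g t \<in> C})"
    using finite_quot disjoint_family_quot
    by (intro measure_pmf.finite_measure_finite_Union[symmetric]) auto
  also have "(\<Union>C\<in>quot J. {t. g t \<in> C}) = UNIV"
    using residue_class_in_quot mem_residue_class_self[OF subgroup] by blast
  finally show ?thesis by simp
qed

lemma prob_light_classes_less:
  assumes "0 < e"
  shows "measure_pmf.prob \<nu> {b. measure_pmf.prob \<nu> (residue_class J b) < e / card (quot J)} < e"
    (is "measure_pmf.prob \<nu> ?light < e")
proof -
  define light where "light = {C \<in> quot J. measure_pmf.prob \<nu> C < e / card (quot J)}"
  have light: "finite light" "?light \<subseteq> \<Union>light"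
    using finite_quot residue_class_in_quot mem_residue_class_self[OF subgroup]
    by (auto simp: light_def)
  show ?thesis
  proof (cases "light = {}")
    case True
    then have "?light = {}" using light(2) by simp
    then show ?thesis using assms by (simp only: measure_empty)
  next
    case False
    have "measure_pmf.prob \<nu> ?light \<le> measure_pmf.prob \<nu> (\<Union>light)"
      using light(2) by (intro measure_pmf.finite_measure_mono) auto
    also have "\<dots> \<le> (\<Sum>C\<in>light. measure_pmf.prob \<nu> C)"
      using measure_pmf.finite_measure_subadditive_finite[of light "\<lambda>C. C" \<nu>] light(1) by simp
    also have "\<dots> < (\<Sum>C\<in>light. e / card (quot J))"
      using False light(1) by (intro sum_strict_mono) (auto simp: light_def)
    also have "\<dots> \<le> (\<Sum>C\<in>quot J. e / card (quot J))"
      using finite_quot assms by (intro sum_mono2) (auto simp: light_def)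
    also have "\<dots> = e" using card_quot_pos by simp
    finally show ?thesis .
  qed
qed

lemma affinely_spanning_heavy_classes:
  assumes bal: "quot_balanced J e \<nu>" and e: "0 < e" "e \<le> 1"
  shows "affinely_spanning {b. e / card (quot J) \<le> measure_pmf.prob \<nu> (residue_class J b)}"
    (is "affinely_spanning ?heavy")
proof -
  have "- ?heavy = {b. measure_pmf.prob \<nu> (residue_class J b) < e / card (quot J)}" by auto
  then have mass: "1 - e < measure_pmf.prob \<nu> ?heavy"
    using prob_light_classes_less[OF e(1), of \<nu>] measure_pmf.prob_compl[of ?heavy \<nu>]
    by (simp add: Compl_eq_Diff_UNIV)
  have "\<not> ?heavy \<subseteq> residue_class W a" if "add_subgroup W \<and> J \<subseteq> W \<and> W \<noteq> UNIV" for W a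
  proof
    assume "?heavy \<subseteq> residue_class W a"
    then have "measure_pmf.prob \<nu> ?heavy \<le> measure_pmf.prob \<nu> {t. t - a \<in> W}"
      unfolding residue_class_def[of W] by (intro measure_pmf.finite_measure_mono) auto
    also have "\<dots> \<le> 1 - e" using bal that unfolding quot_balanced_def by blast
    finally show False using mass by simp
  qed
  moreover have "?heavy \<noteq> {}" using mass e(2) by (intro notI) simp
  ultimately show ?thesis unfolding affinely_spanning_def by blast
qed

definition sum_class_prob ::
  "('i \<Rightarrow> 'b \<Rightarrow> 'a) \<Rightarrow> 'b \<Rightarrow> ('i \<Rightarrow> 'b pmf) \<Rightarrow> 'i set \<Rightarrow> 'a \<Rightarrow> real" where
  "sum_class_prob f d \<mu> A z =
     measure_pmf.prob (Pi_pmf A d \<mu>) {X. (\<Sum>i\<in>A. f i (X i)) \<in> residue_class J z}"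

lemma sum_class_prob_lower:
  assumes A: "finite A" "card (quot J) \<le> card A" and e: "0 < e" "e \<le> 1"
    and bal: "\<And>i. i \<in> A \<Longrightarrow> quot_balanced J e (map_pmf (f i) (\<mu> i))"
  shows "(e / card (quot J)) ^ card A \<le> sum_class_prob f d \<mu> A z"
proof -
  define B where "B i =
    {b. e / card (quot J) \<le> measure_pmf.prob (map_pmf (f i) (\<mu> i)) (residue_class J b)}" for i
  have "affinely_spanning (B i)" if "i \<in> A" for i
    unfolding B_def using bal[OF that] e by (rule affinely_spanning_heavy_classes)
  then obtain b where b: "\<And>i. i \<in> A \<Longrightarrow> b i \<in> B i" "(\<Sum>i\<in>A. b i) \<in> residue_class J z"
    using exists_sum_in_class[OF A, of B z] by blast
  have "(e / card (quot J)) ^ card A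
      \<le> (\<Prod>i\<in>A. measure_pmf.prob (map_pmf (f i) (\<mu> i)) (residue_class J (b i)))"
    using b(1) e(1)
    by (intro prod_mono[of A "\<lambda>_. e / card (quot J)", simplified]) (auto simp: B_def)
  also have "\<dots> = measure_pmf.prob (Pi_pmf A d \<mu>) (Pi A (\<lambda>i. {x. f i x \<in> residue_class J (b i)}))"
    using A(1) by (simp add: measure_Pi_pmf_Pi vimage_def)
  also have "\<dots> \<le> sum_class_prob f d \<mu> A z"
    unfolding sum_class_prob_def
  proof (intro measure_pmf.finite_measure_mono subsetI CollectI)
    fix X assume X: "X \<in> Pi A (\<lambda>i. {x. f i x \<in> residue_class J (b i)})"
    have "(\<Sum>i\<in>A. f i (X i) - b i) \<in> J"
      using A(1) X by (induction A rule: finite_induct)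
        (auto simp: residue_class_def add_subgroup_zero add_subgroup_add subgroup)
    then have "(\<Sum>i\<in>A. f i (X i) - b i) + ((\<Sum>i\<in>A. b i) - z) \<in> J"
      using b(2) by (intro add_subgroup_add[OF subgroup]) (auto simp: residue_class_def)
    then show "(\<Sum>i\<in>A. f i (X i)) \<in> residue_class J z" by (simp add: residue_class_def sum_subtractf)
  qed simp
  finally show ?thesis .
qed

end

lemma prob_pair_pmf_Times:
  "measure_pmf.prob (pair_pmf M N) (A \<times> B) = measure_pmf.prob M A * measure_pmf.prob N B"
proof -
  have "(A \<times> B) \<inter> set_pmf (pair_pmf M N) = (A \<inter> set_pmf M) \<times> (B \<inter> set_pmf N)" by auto
  then have "measure_pmf.prob (pair_pmf M N) (A \<times> B)
      = measure_pmf.prob (pair_pmf M N) ((A \<inter> set_pmf M) \<times> (B \<inter> set_pmf N))"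
    by (metis measure_Int_set_pmf)
  then show ?thesis by (simp add: measure_pmf_prob_product measure_Int_set_pmf)
qed

context finite_index_subgroup
begin

lemma sum_class_prob_Un:
  assumes AB: "finite A" "finite B" "A \<inter> B = {}"
  shows "sum_class_prob f d \<mu> (A \<union> B) z = (\<Sum>C\<in>quot J.
    measure_pmf.prob (Pi_pmf A d \<mu>) {X. (\<Sum>i\<in>A. f i (X i)) \<in> C} *
    measure_pmf.prob (Pi_pmf B d \<mu>) {Y. z - (\<Sum>i\<in>B. f i (Y i)) \<in> C})"
proof -
  let ?S = "\<lambda>X. \<Sum>i\<in>A. f i (X i)" and ?T = "\<lambda>Y. \<Sum>i\<in>B. f i (Y i)"
  let ?pair = "pair_pmf (Pi_pmf A d \<mu>) (Pi_pmf B d \<mu>)"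
  have sum_Un: "(\<Sum>i\<in>A \<union> B. f i (if i \<in> A then X i else Y i)) = ?S X + ?T Y" for X Y
  proof -
    have "(\<Sum>i\<in>B. f i (if i \<in> A then X i else Y i)) = ?T Y"
      using AB(3) by (intro sum.cong) auto
    then show ?thesis using AB by (simp add: sum.union_disjoint)
  qed
  have same_class: "?S X + ?T Y \<in> residue_class J z \<longleftrightarrow> (\<exists>C\<in>quot J. ?S X \<in> C \<and> z - ?T Y \<in> C)" for X Y
  proof -
    have "?S X + ?T Y \<in> residue_class J z \<longleftrightarrow> ?S X \<in> residue_class J (z - ?T Y)"
      by (simp add: residue_class_def algebra_simps)
    then show ?thesis
      using quot_eq_residue_class residue_class_in_quot mem_residue_class_self[OF subgroup] by metis
  qed
  have "sum_class_prob f d \<mu> (A \<union> B) z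
    = measure_pmf.prob ?pair {XY. ?S (fst XY) + ?T (snd XY) \<in> residue_class J z}"
    unfolding sum_class_prob_def Pi_pmf_union[OF AB] by (simp add: vimage_def case_prod_beta sum_Un)
  also have "{XY. ?S (fst XY) + ?T (snd XY) \<in> residue_class J z}
    = (\<Union>C\<in>quot J. {X. ?S X \<in> C} \<times> {Y. z - ?T Y \<in> C})"
  proof (rule Set.set_eqI)
    show "XY \<in> {XY. ?S (fst XY) + ?T (snd XY) \<in> residue_class J z} \<longleftrightarrow>
        XY \<in> (\<Union>C\<in>quot J. {X. ?S X \<in> C} \<times> {Y. z - ?T Y \<in> C})" for XY
      using same_class[of "fst XY" "snd XY"] by (simp add: mem_Times_iff)
  qed
  also have "measure_pmf.prob ?pair \<dots>
    = (\<Sum>C\<in>quot J. measure_pmf.prob ?pair ({X. ?S X \<in> C} \<times> {Y. z - ?T Y \<in> C}))"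
  proof (rule measure_pmf.finite_measure_finite_Union[OF finite_quot])
    show "disjoint_family_on (\<lambda>C. {X. ?S X \<in> C} \<times> {Y. z - ?T Y \<in> C}) (quot J)"
      using disjoint_family_quot[of ?S] by (simp add: disjoint_family_on_def Times_Int_Times)
  qed simp
  finally show ?thesis by (simp add: prob_pair_pmf_Times)
qed

lemma sum_class_prob_contract:
  fixes c m :: real
  assumes AB: "finite A" "finite B" "A \<inter> B = {}"
    and lower: "\<And>z. c \<le> sum_class_prob f d \<mu> A z"
    and upper: "\<And>z. sum_class_prob f d \<mu> B z \<le> m"
  shows "sum_class_prob f d \<mu> (A \<union> B) z \<le> (1 - card (quot J) * c) * m + c"
proof -
  define P where "P C = measure_pmf.prob (Pi_pmf A d \<mu>) {X. (\<Sum>i\<in>A. f i (X i)) \<in> C}" for C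
  define Q where "Q C = measure_pmf.prob (Pi_pmf B d \<mu>) {Y. z - (\<Sum>i\<in>B. f i (Y i)) \<in> C}" for C
  have PQ: "c \<le> P C" "Q C \<le> m" if "C \<in> quot J" for C
  proof -
    from that obtain y where C: "C = residue_class J y" by (auto simp: quot_eq_range[OF subgroup])
    show "c \<le> P C" using lower[of y] by (simp add: P_def C sum_class_prob_def)
    have "z - s \<in> C \<longleftrightarrow> s \<in> residue_class J (z - y)" for s
      using add_subgroup_minus[OF subgroup, of "z - s - y"]
        add_subgroup_minus[OF subgroup, of "s - (z - y)"]
      by (auto simp: C residue_class_def algebra_simps)
    then show "Q C \<le> m" using upper[of "z - y"] by (simp add: Q_def sum_class_prob_def)
  qed
  have sums: "(\<Sum>C\<in>quot J. P C) = 1" "(\<Sum>C\<in>quot J. Q C) = 1"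
    unfolding P_def Q_def by (rule sum_prob_quot)+
  have "sum_class_prob f d \<mu> (A \<union> B) z = (\<Sum>C\<in>quot J. (P C - c) * Q C) + c * (\<Sum>C\<in>quot J. Q C)"
    unfolding sum_class_prob_Un[OF AB] P_def[symmetric] Q_def[symmetric]
    by (simp add: sum_distrib_left algebra_simps flip: sum.distrib)
  also have "\<dots> \<le> (\<Sum>C\<in>quot J. (P C - c) * m) + c"
    unfolding sums using PQ by (intro add_mono sum_mono mult_left_mono) auto
  also have "(\<Sum>C\<in>quot J. (P C - c) * m) = (1 - card (quot J) * c) * m"
    by (simp add: sums sum_subtractf flip: sum_distrib_right)
  finally show ?thesis .
qed

lemma card_quot_mult_power_le_1:
  assumes "0 < e" "e \<le> 1"
  shows "card (quot J) * (e / card (quot J)) ^ card (quot J) \<le> 1"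
proof -
  have card_ge_1: "1 \<le> real (card (quot J))" using card_quot_pos by linarith
  have "(e / card (quot J)) ^ card (quot J) \<le> (e / card (quot J)) ^ 1"
    using assms card_ge_1 card_quot_pos by (intro power_decreasing) (auto simp: divide_le_eq)
  then have "card (quot J) * (e / card (quot J)) ^ card (quot J)
      \<le> card (quot J) * (e / card (quot J))"
    using card_ge_1 by (intro mult_left_mono) auto
  then show ?thesis using assms card_ge_1 by simp
qed

lemma sum_class_prob_upper:
  fixes c e :: real
  defines "c \<equiv> (e / card (quot J)) ^ card (quot J)"
  assumes e: "0 < e" "e \<le> 1"
    and "finite A" "k * card (quot J) \<le> card A"
    and "\<And>i. i \<in> A \<Longrightarrow> quot_balanced J e (map_pmf (f i) (\<mu> i))"
  shows "sum_class_prob f d \<mu> A z \<le> 1 / card (quot J) + (1 - card (quot J) * c) ^ k"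
  using assms(4-6)
proof (induction k arbitrary: A z)
  case 0
  have "sum_class_prob f d \<mu> A z \<le> 1" by (simp add: sum_class_prob_def)
  then show ?case by (simp add: add_increasing)
next
  case (Suc k)
  have card_pos: "real (card (quot J)) > 0" using card_quot_pos by simp
  have "card (quot J) \<le> card A" using Suc.prems(2) by simp
  then obtain B where B: "B \<subseteq> A" "card B = card (quot J)" by (meson obtain_subset_with_card_n)
  have fin: "finite B" "finite (A - B)" using B(1) Suc.prems(1) finite_subset by auto
  have "sum_class_prob f d \<mu> (B \<union> (A - B)) z
      \<le> (1 - card (quot J) * c) * (1 / card (quot J) + (1 - card (quot J) * c) ^ k) + c"
  proof (intro sum_class_prob_contract fin)
    show "c \<le> sum_class_prob f d \<mu> B y" for y
      using sum_class_prob_lower[OF fin(1) _ e, of f \<mu> d y] B Suc.prems(3) by (auto simp: c_def)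
    show "sum_class_prob f d \<mu> (A - B) y \<le> 1 / card (quot J) + (1 - card (quot J) * c) ^ k" for y
    proof (rule Suc.IH[OF fin(2)])
      show "k * card (quot J) \<le> card (A - B)"
        using Suc.prems(2) B fin(1) by (simp add: card_Diff_subset)
    qed (use Suc.prems(3) in auto)
  qed auto
  also have "\<dots> = 1 / card (quot J) + (1 - card (quot J) * c) ^ Suc k"
    using card_pos by (simp add: field_simps)
  finally show ?case using B(1) by (simp add: Un_absorb1)
qed

lemma sum_class_equidistribution:
  assumes e: "0 < e" "e \<le> 1" and "0 < \<delta>"
  obtains s where "\<And>A (f :: 'i \<Rightarrow> 'b \<Rightarrow> 'a) d \<mu> z. finite A \<Longrightarrow> s \<le> card A \<Longrightarrow>
    (\<And>i. i \<in> A \<Longrightarrow> quot_balanced J e (map_pmf (f i) (\<mu> i))) \<Longrightarrow>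
    sum_class_prob f d \<mu> A z \<le> 1 / card (quot J) + \<delta>"
proof -
  define r where "r = 1 - card (quot J) * (e / card (quot J)) ^ card (quot J)"
  have "0 \<le> r" using card_quot_mult_power_le_1[OF e] by (simp add: r_def)
  moreover have "r < 1" using e(1) card_quot_pos by (simp add: r_def)
  ultimately obtain k where k: "r ^ k < \<delta>" using real_arch_pow_inv[of \<delta> r] \<open>0 < \<delta>\<close> by auto
  show thesis
  proof (rule that[of "k * card (quot J)"])
    fix A :: "'i set" and f :: "'i \<Rightarrow> 'b \<Rightarrow> 'a" and d \<mu> z
    assume "finite A" "k * card (quot J) \<le> card A"
      and "\<And>i. i \<in> A \<Longrightarrow> quot_balanced J e (map_pmf (f i) (\<mu> i))"
    then have "sum_class_prob f d \<mu> A z \<le> 1 / card (quot J) + r ^ k"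
      unfolding r_def by (intro sum_class_prob_upper e)
    with k show "sum_class_prob f d \<mu> A z \<le> 1 / card (quot J) + \<delta>" by simp
  qed
qed

end


section \<open>Elementary abelian quotients\<close>

lemma of_int_mem_ideal:
  fixes I :: "'a::comm_ring_1 set"
  assumes "is_ideal I" "of_nat l \<in> I" "int l dvd k"
  shows "of_int k \<in> I"
proof -
  obtain j where "k = int l * j" using assms(3) by (elim dvdE)
  then have "of_int k = of_int j * (of_nat l :: 'a)" by simp
  then show ?thesis using ideal_mult_left[OF assms(1,2)] by simp
qed

text \<open>Linear independence over \<open>\<int>/l\<int>\<close> of the classes of \<open>b\<^sub>0, \<dots>, b\<^sub>m\<^sub>-\<^sub>1\<close> modulo \<open>I\<close>.\<close>
definition independent_mod :: "nat \<Rightarrow> 'a::comm_ring_1 set \<Rightarrow> nat \<Rightarrow> (nat \<Rightarrow> 'a) \<Rightarrow> bool" where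
  "independent_mod l I m b \<longleftrightarrow>
     (\<forall>k. (\<Sum>i<m. of_int (k i) * b i) \<in> I \<longrightarrow> (\<forall>i<m. int l dvd k i))"

lemma independent_mod_inj:
  assumes "independent_mod l I m b"
    and xy: "x \<in> {..<m} \<rightarrow>\<^sub>E {..<l}" "y \<in> {..<m} \<rightarrow>\<^sub>E {..<l}"
    and "(\<Sum>i<m. of_nat (x i) * b i) - (\<Sum>i<m. of_nat (y i) * b i) \<in> I"
  shows "x = y"
proof (rule PiE_ext[OF xy])
  fix i assume i: "i \<in> {..<m}"
  have "(\<Sum>i<m. of_int (int (x i) - int (y i)) * b i) \<in> I"
    using assms(4) by (simp add: left_diff_distrib sum_subtractf)
  from assms(1)[unfolded independent_mod_def, rule_format, OF this]
  have "int (x i) mod int l = int (y i) mod int l" using i by (simp add: mod_eq_dvd_iff)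
  moreover have "x i < l" "y i < l" using PiE_mem[OF xy(1) i] PiE_mem[OF xy(2) i] by auto
  ultimately show "x i = y i" by simp
qed

lemma independent_mod_extend:
  fixes I :: "'a::comm_ring_1 set"
  assumes I: "is_ideal I" and l: "prime l" "of_nat l \<in> I"
    and b: "independent_mod l I m b"
    and t: "\<And>k. t - (\<Sum>i<m. of_int (k i) * b i) \<notin> I"
  shows "independent_mod l I (Suc m) (b(m := t))"
  unfolding independent_mod_def
proof (intro allI impI)
  fix k i assume "(\<Sum>i<Suc m. of_int (k i) * (b(m := t)) i) \<in> I" and i: "i < Suc m"
  then have k: "(\<Sum>i<m. of_int (k i) * b i) + of_int (k m) * t \<in> I" by simp
  have dvd_last: "int l dvd k m"
  proof (rule ccontr)
    assume "\<not> int l dvd k m"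
    then have "coprime (int l) (k m)" using l(1) prime_imp_coprime[of "int l" "k m"] by simp
    then obtain u v where bezout: "u * int l + v * k m = 1"
      using bezout_int[of "int l" "k m"] by auto
    have "of_int v * ((\<Sum>i<m. of_int (k i) * b i) + of_int (k m) * t) + of_int (u * int l) * t \<in> I"
      by (intro ideal_add ideal_mult_left ideal_mult_right I k of_int_mem_ideal[OF I l(2)]) simp
    also have "of_int v * ((\<Sum>i<m. of_int (k i) * b i) + of_int (k m) * t) + of_int (u * int l) * t
      = of_int (u * int l + v * k m) * t - (\<Sum>i<m. of_int (- v * k i) * b i)"
      by (simp add: algebra_simps sum_distrib_left sum_negf)
    finally show False using t[of "\<lambda>i. - v * k i"] by (simp add: bezout)
  qed
  have "((\<Sum>i<m. of_int (k i) * b i) + of_int (k m) * t) - of_int (k m) * t \<in> I"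
    by (intro ideal_diff[OF I k] ideal_mult_right I of_int_mem_ideal[OF I l(2) dvd_last])
  then have "\<forall>i<m. int l dvd k i" using b by (simp add: independent_mod_def)
  with dvd_last i show "int l dvd k i" by (auto simp: less_Suc_eq)
qed

lemma independent_mod_bounded:
  fixes I :: "'a::comm_ring_1 set"
  assumes I: "is_ideal I" and fin: "finite (quot I)" and "2 \<le> l" and b: "independent_mod l I m b"
  shows "m < card (quot I)"
proof -
  let ?V = "{..<m} \<rightarrow>\<^sub>E {..<l}"
  note subgroup = ideal_add_subgroup[OF I]
  have "inj_on (\<lambda>x. residue_class I (\<Sum>i<m. of_nat (x i) * b i)) ?V"
    using independent_mod_inj[OF b] by (auto simp: inj_on_def residue_class_eq_iff[OF subgroup])
  then have "card ?V \<le> card (quot I)"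
    by (rule card_inj_on_le) (use fin in \<open>auto simp: quot_eq_range[OF subgroup]\<close>)
  then have "l ^ m \<le> card (quot I)" by (simp add: card_PiE)
  moreover have "m < 2 ^ m" by (rule less_exp)
  moreover have "2 ^ m \<le> l ^ m" using \<open>2 \<le> l\<close> by (intro power_mono) auto
  ultimately show ?thesis by linarith
qed

lemma exists_basis_mod:
  fixes I :: "'a::comm_ring_1 set"
  assumes I: "is_ideal I" and fin: "finite (quot I)" and l: "prime l" "of_nat l \<in> I"
  obtains m b where "independent_mod l I m b" "\<And>t. \<exists>k. t - (\<Sum>i<m. of_int (k i) * b i) \<in> I"
proof -
  have "\<exists>m. (\<exists>b. independent_mod l I m b) \<and> (\<forall>m'. (\<exists>b. independent_mod l I m' b) \<longrightarrow> m' \<le> m)"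
  proof (rule ex_has_greatest_nat)
    show "\<exists>b. independent_mod l I 0 b" by (simp add: independent_mod_def)
    show "\<forall>m. (\<exists>b. independent_mod l I m b) \<longrightarrow> m < card (quot I)"
      using independent_mod_bounded[OF I fin prime_ge_2_nat[OF l(1)]] by blast
  qed
  then obtain m b where b: "independent_mod l I m b"
    and max: "\<not> independent_mod l I (Suc m) b'" for b'
    by (meson not_less_eq_eq order_refl)
  from independent_mod_extend[OF I l b] max have "\<exists>k. t - (\<Sum>i<m. of_int (k i) * b i) \<in> I" for t
    by blast
  with b show thesis by (rule that)
qed

lemma reduce_coefficients_mod:
  fixes I :: "'a::comm_ring_1 set" and m :: nat
  assumes I: "is_ideal I" and l: "prime l" "of_nat l \<in> I"
  defines "digits k \<equiv> \<lambda>i\<in>{..<m}. nat (k i mod int l)"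
  shows "digits k \<in> {..<m} \<rightarrow>\<^sub>E {..<l}"
    and "(\<Sum>i<m. of_int (k i) * b i) - (\<Sum>i<m. of_nat (digits k i) * b i) \<in> I"
proof -
  have "0 < l" using l(1) by (rule prime_gt_0_nat)
  then show "digits k \<in> {..<m} \<rightarrow>\<^sub>E {..<l}" by (auto simp: digits_def nat_less_iff)
  have "(\<Sum>i<m. of_int (k i) * b i) - (\<Sum>i<m. of_nat (digits k i) * b i)
    = (\<Sum>i<m. of_int (k i - k i mod int l) * b i)"
    unfolding sum_subtractf[symmetric] using \<open>0 < l\<close>
    by (intro sum.cong) (auto simp: digits_def left_diff_distrib)
  also have "\<dots> \<in> I"
    by (intro ideal_sum[OF I] ideal_mult_right[OF I] of_int_mem_ideal[OF I l(2)]) simp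
  finally show "(\<Sum>i<m. of_int (k i) * b i) - (\<Sum>i<m. of_nat (digits k i) * b i) \<in> I" .
qed

lemma elem_abelian_quotI:
  fixes I :: "'a::comm_ring_1 set"
  assumes I: "is_ideal I" "I \<noteq> UNIV" and fin: "finite (quot I)" and l: "prime l" "of_nat l \<in> I"
  shows "elem_abelian_quot I"
proof -
  obtain m b where b: "independent_mod l I m b" "\<And>t. \<exists>k. t - (\<Sum>i<m. of_int (k i) * b i) \<in> I"
    using exists_basis_mod[OF I(1) fin l] by blast
  define V where "V = {..<m} \<rightarrow>\<^sub>E {..<l}"
  define f where "f x = (\<Sum>i<m. of_nat (x i) * b i)" for x :: "nat \<Rightarrow> nat"
  note digits = reduce_coefficients_mod(1)[OF I(1) l, where m = m, folded V_def]
  note reduce = reduce_coefficients_mod(2)[OF I(1) l, where m = m and b = b, folded f_def]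
  have "0 < m"
  proof (rule ccontr)
    assume "\<not> 0 < m"
    then have "t \<in> I" for t using b(2)[of t] by simp
    then show False using I(2) by blast
  qed
  have "f (restrict (\<lambda>i. (x i + y i) mod l) {..<m}) - f x - f y \<in> I" for x y
  proof -
    have "(\<lambda>i\<in>{..<m}. nat (int (x i + y i) mod int l)) = restrict (\<lambda>i. (x i + y i) mod l) {..<m}"
      by (simp only: zmod_int[symmetric] nat_int)
    moreover have "(\<Sum>i<m. of_int (int (x i + y i)) * b i) = f x + f y"
      by (simp add: f_def distrib_right sum.distrib)
    ultimately have "f x + f y - f (restrict (\<lambda>i. (x i + y i) mod l) {..<m}) \<in> I"
      using reduce[of "\<lambda>i. int (x i + y i)"] by (simp only:)
    from ideal_minus[OF I(1) this] show ?thesis by (simp add: algebra_simps)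
  qed
  moreover have "\<exists>x\<in>V. t - f x \<in> I" for t
  proof -
    obtain k where k: "t - (\<Sum>i<m. of_int (k i) * b i) \<in> I" using b(2) by blast
    define x where "x = (\<lambda>i\<in>{..<m}. nat (k i mod int l))"
    have "t - f x \<in> I" using ideal_add[OF I(1) k reduce[of k, folded x_def]] by simp
    then show ?thesis using digits[of k, folded x_def] by blast
  qed
  moreover have "x = y" if "x \<in> V" "y \<in> V" "f x - f y \<in> I" for x y
    using independent_mod_inj[OF b(1)] that unfolding V_def f_def by blast
  ultimately show ?thesis
    unfolding elem_abelian_quot_def Let_def using l(1) \<open>0 < m\<close>
    by (intro exI[of _ l] exI[of _ m] exI[of _ f]) (auto simp: V_def)
qed


section \<open>Balancedness modulo powers of a prime\<close>

lemma exists_prime_in_prime_ideal: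
  fixes p :: "'a::idom set"
  assumes p: "is_prime_ideal p" and fin: "finite (quot p)"
  obtains l where "prime l" "of_nat l \<in> p"
proof -
  have ideal: "is_ideal p" and one_notin: "1 \<notin> p"
    using p ideal_eq_UNIV_iff by (auto simp: is_prime_ideal_def)
  note subgroup = ideal_add_subgroup[OF ideal]
  have "range (\<lambda>n::nat. residue_class p (of_nat n)) \<subseteq> quot p"
    by (auto simp: quot_eq_range[OF subgroup])
  then have "\<not> inj (\<lambda>n::nat. residue_class p (of_nat n))"
    using fin finite_subset range_inj_infinite by metis
  then obtain i j :: nat where "i < j" "of_nat j - of_nat i \<in> p"
    unfolding inj_def residue_class_eq_iff[OF subgroup]
    by (metis ideal_minus[OF ideal] linorder_neqE_nat minus_diff_eq)
  then have "0 < j - i" "of_nat (j - i) \<in> p" by auto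
  moreover have "\<exists>l. prime l \<and> of_nat l \<in> p" if "0 < n" "of_nat n \<in> p" for n :: nat
    using that
  proof (induction n rule: less_induct)
    case (less n)
    then have "n \<noteq> 1" using one_notin by auto
    then obtain l k where lk: "prime l" "n = l * k" by (meson dvdE prime_factor_nat)
    then have "of_nat l \<in> p \<or> of_nat k \<in> p" using less.prems(2) p by (auto simp: is_prime_ideal_def)
    moreover have "0 < k" "k < n" using less.prems(1) lk prime_gt_1_nat[of l] by auto
    ultimately show ?case using less.IH[of k] lk(1) by auto
  qed
  ultimately obtain l where "prime l" "of_nat l \<in> p" by blast
  then show thesis by (rule that)
qed

lemma add_subgroup_plus:
  assumes "add_subgroup V" "add_subgroup W"
  shows "add_subgroup (V + W)"
  unfolding add_subgroup_def
proof (intro conjI ballI)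
  show "0 \<in> V + W" using set_plus_intro[of 0 V 0 W] assms by (simp add: add_subgroup_zero)
next
  fix x y assume "x \<in> V + W" "y \<in> V + W"
  then obtain a b c d where "x + y = (a + c) + (b + d)" "a \<in> V" "b \<in> W" "c \<in> V" "d \<in> W"
    by (auto elim!: set_plus_elim simp: ac_simps)
  then show "x + y \<in> V + W" using assms by (auto intro: add_subgroup_add)
next
  fix x assume "x \<in> V + W"
  then obtain a b where "- x = (- a) + (- b)" "a \<in> V" "b \<in> W" by (auto elim!: set_plus_elim)
  then show "- x \<in> V + W" using assms by (metis add_subgroup_minus set_plus_intro)
qed

lemma add_subgroup_of_nat_mult:
  fixes W :: "'a::comm_ring_1 set"
  assumes "add_subgroup W" "x \<in> W"
  shows "of_nat n * x \<in> W"
  by (induction n)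
    (auto simp: distrib_right add_subgroup_zero[OF assms(1)] add_subgroup_add[OF assms(1)] assms(2))

lemma subgroup_plus_multiples_eq_UNIV:
  fixes W :: "'a::comm_ring_1 set"
  assumes W: "add_subgroup W" and full: "W + {x. of_nat l dvd x} = UNIV"
    and power: "\<And>y. of_nat (l ^ m) * y \<in> W"
  shows "W = UNIV"
proof -
  have "\<exists>x\<in>W. \<exists>y. z = x + of_nat (l ^ k) * y" for k z
  proof (induction k)
    case 0
    have "z = 0 + of_nat (l ^ 0) * z" by simp
    then show ?case using add_subgroup_zero[OF W] by blast
  next
    case (Suc k)
    then obtain x y where xy: "x \<in> W" "z = x + of_nat (l ^ k) * y" by blast
    have "y \<in> W + {x. of_nat l dvd x}" by (simp add: full)
    then obtain x' y' where xy': "x' \<in> W" "y = x' + of_nat l * y'"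
      by (auto elim!: set_plus_elim dvdE)
    have "z = (x + of_nat (l ^ k) * x') + of_nat (l ^ Suc k) * y'"
      unfolding xy xy' by (simp add: algebra_simps)
    moreover have "x + of_nat (l ^ k) * x' \<in> W"
      by (intro add_subgroup_add add_subgroup_of_nat_mult W xy(1) xy'(1))
    ultimately show ?case by blast
  qed
  then have "z \<in> W" for z using power add_subgroup_add[OF W] by metis
  then show ?thesis by blast
qed

lemma quot_balanced_mult_unit:
  fixes J :: "'a::comm_ring_1 set"
  assumes J: "is_ideal J" and bal: "quot_balanced J e \<nu>" and e: "e \<le> 1" and ur: "1 - u * r \<in> J"
  shows "quot_balanced J e (map_pmf ((*) u) \<nu>)"
  unfolding quot_balanced_def
proof (intro allI impI)
  fix W a assume W: "add_subgroup W \<and> J \<subseteq> W \<and> W \<noteq> UNIV"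
  then have subgroup: "add_subgroup W" by blast
  have prob_image: "measure_pmf.prob (map_pmf ((*) u) \<nu>) {t. t - a \<in> W}
      = measure_pmf.prob \<nu> {x. u * x - a \<in> W}"
    by (simp add: vimage_def)
  show "measure_pmf.prob (map_pmf ((*) u) \<nu>) {t. t - a \<in> W} \<le> 1 - e"
  proof (cases "\<exists>x0. u * x0 - a \<in> W")
    case False
    then show ?thesis using e unfolding prob_image by simp
  next
    case True
    then obtain x0 where x0: "u * x0 - a \<in> W" by blast
    define W' where "W' = {x. u * x \<in> W}"
    have "add_subgroup W'" using subgroup by (auto simp: add_subgroup_def W'_def distrib_left)
    moreover have "J \<subseteq> W'" unfolding W'_def using W ideal_mult_left[OF J] by blast
    moreover have "W' \<noteq> UNIV"
    proof
      assume full: "W' = UNIV"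
      have "z \<in> W" for z
      proof -
        have "(1 - u * r) * z \<in> W" using W ideal_mult_right[OF J ur] by blast
        moreover have "u * (r * z) \<in> W" using full unfolding W'_def by blast
        ultimately have "(1 - u * r) * z + u * (r * z) \<in> W" by (rule add_subgroup_add[OF subgroup])
        then show ?thesis by (simp add: algebra_simps)
      qed
      then show False using W by blast
    qed
    ultimately have "measure_pmf.prob \<nu> {t. t - x0 \<in> W'} \<le> 1 - e"
      using bal unfolding quot_balanced_def by blast
    moreover have "measure_pmf.prob \<nu> {x. u * x - a \<in> W} \<le> measure_pmf.prob \<nu> {t. t - x0 \<in> W'}"
    proof (intro measure_pmf.finite_measure_mono subsetI)
      fix x assume "x \<in> {x. u * x - a \<in> W}"
      then have "(u * x - a) - (u * x0 - a) \<in> W" using add_subgroup_diff[OF subgroup] x0 by blast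
      then show "x \<in> {t. t - x0 \<in> W'}" by (simp add: W'_def algebra_simps)
    qed simp
    ultimately show ?thesis unfolding prob_image by linarith
  qed
qed

locale finite_residue_prime = dedekind_prime +
  assumes finite_residues: "finite_residues TYPE('a)"
begin

lemma pow_subset: "0 < k \<Longrightarrow> ideal_pow p k \<subseteq> p"
  using ideal_pow_antimono[of 1 k p] ideal_pow_1[OF ideal] by simp

lemma finite_index_pow: "finite_index_subgroup (ideal_pow p k)"
proof
  show "add_subgroup (ideal_pow p k)" by (rule ideal_add_subgroup[OF is_ideal_ideal_pow])
  show "finite (quot (ideal_pow p k))"
  proof (cases "k = 0")
    case True
    have "quot (UNIV :: 'a set) \<subseteq> {UNIV}" by (auto simp: quot_def quotient_def ideal_rel_def)
    then show ?thesis using True finite_subset by auto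
  next
    case False
    then have "ideal_pow p k \<noteq> UNIV" using pow_subset one_notin by blast
    then show ?thesis
      using finite_residues[unfolded finite_residues_def, rule_format, of "ideal_pow p k"]
      by (simp add: is_ideal_ideal_pow pow_nonzero)
  qed
qed

lemma card_quot_pow: "k < card (quot (ideal_pow p k))"
proof -
  interpret finite_index_subgroup "ideal_pow p k" by (rule finite_index_pow)
  have "inj_on (\<lambda>i. residue_class (ideal_pow p k) (\<pi> ^ i)) {..k}"
  proof (rule linorder_inj_onI)
    fix i j assume ij: "i < j" "i \<in> {..k}" "j \<in> {..k}"
    have "\<pi> ^ i - \<pi> ^ j \<notin> ideal_pow p k"
    proof
      assume "\<pi> ^ i - \<pi> ^ j \<in> ideal_pow p k"
      then have "\<pi> ^ i - \<pi> ^ j \<in> ideal_pow p (Suc i)"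
        using ideal_pow_antimono[of "Suc i" k] ij by auto
      moreover have "\<pi> ^ j \<in> ideal_pow p (Suc i)"
        using ij(1) pi_nonzero by (simp add: mem_pow_iff_val val_pi_power)
      ultimately have "(\<pi> ^ i - \<pi> ^ j) + \<pi> ^ j \<in> ideal_pow p (Suc i)"
        by (rule ideal_add[OF is_ideal_ideal_pow])
      then show False using pi_nonzero by (simp add: mem_pow_iff_val val_pi_power)
    qed
    then show "residue_class (ideal_pow p k) (\<pi> ^ i) \<noteq> residue_class (ideal_pow p k) (\<pi> ^ j)"
      by (simp add: residue_class_eq_iff[OF subgroup])
  qed auto
  then have "card {..k} \<le> card (quot (ideal_pow p k))"
    by (rule card_inj_on_le) (auto simp: residue_class_in_quot finite_quot)
  then show ?thesis by simp
qed

lemma pow_plus_multiples_in_Ical: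
  assumes k: "0 < k" and l: "prime l" "of_nat l \<in> p"
  shows "ideal_pow p k + {x. of_nat l dvd x} \<in> Ical" (is "?I \<in> Ical")
proof -
  have multiples: "is_ideal {x :: 'a. of_nat l dvd x}"
    using is_ideal_dvd_mult[of "of_nat l :: 'a" 1] by simp
  have I: "is_ideal ?I" by (intro is_ideal_plus is_ideal_ideal_pow multiples)
  have "ideal_pow p k \<subseteq> ?I" by (rule ideal_subset_plus[OF multiples])
  then have I_nonzero: "?I \<noteq> {0}"
    using pow_nonzero[of k] ideal_zero[OF is_ideal_ideal_pow[of p k]] by blast
  have "?I \<subseteq> p"
    using pow_subset[OF k] l(2)
    by (auto elim!: set_plus_elim dvdE intro!: ideal_add[OF ideal] ideal_mult_right[OF ideal])
  then have "?I \<noteq> UNIV" using one_notin by blast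
  moreover have "finite (quot ?I)"
    using finite_residues I I_nonzero \<open>?I \<noteq> UNIV\<close> unfolding finite_residues_def by blast
  moreover have "of_nat l \<in> ?I"
    using set_plus_intro[OF ideal_zero[OF is_ideal_ideal_pow],
        of "of_nat l" "{x. of_nat l dvd x}" p k]
    by simp
  ultimately show ?thesis
    using I I_nonzero l(1) by (auto simp: Ical_def intro: elem_abelian_quotI)
qed

text \<open>Enlarging \<open>p\<^sup>k\<close> by \<open>l T\<close>, for the prime number \<open>l \<in> p\<close>, keeps proper subgroups proper because
  \<open>l\<^sup>k \<in> p\<^sup>k\<close>.\<close>
lemma quot_balanced_pow:
  fixes \<epsilon> :: "'a set \<Rightarrow> real"
  assumes eps: "\<forall>I\<in>Ical. \<epsilon> I > 0" and k: "0 < k"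
  obtains e where "0 < e" "e < 1" "\<And>\<nu>. eps_balanced \<epsilon> \<nu> \<Longrightarrow> quot_balanced (ideal_pow p k) e \<nu>"
proof -
  have "finite (quot p)"
    using finite_index_pow[of 1] unfolding ideal_pow_1[OF ideal] finite_index_subgroup_def by blast
  then obtain l where l: "prime l" "of_nat l \<in> p"
    using exists_prime_in_prime_ideal[OF prime] by blast
  define lT where "lT = {x :: 'a. of_nat l dvd x}"
  define I where "I = ideal_pow p k + lT"
  have lT: "is_ideal lT" using is_ideal_dvd_mult[of "of_nat l :: 'a" 1] by (simp add: lT_def)
  have Ical: "I \<in> Ical" unfolding I_def lT_def using k l by (rule pow_plus_multiples_in_Ical)
  define e where "e = min (\<epsilon> I) (1/2)"
  have "quot_balanced (ideal_pow p k) e \<nu>" if nu: "eps_balanced \<epsilon> \<nu>" for \<nu>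
    unfolding quot_balanced_def
  proof (intro allI impI)
    fix W a assume W: "add_subgroup W \<and> ideal_pow p k \<subseteq> W \<and> W \<noteq> UNIV"
    have "of_nat (l ^ k) * y \<in> W" for y
      using W ideal_mult_right[OF is_ideal_ideal_pow power_mem_ideal_pow[OF l(2)], of k y] by auto
    then have "W + lT \<noteq> UNIV"
      using W subgroup_plus_multiples_eq_UNIV[of W l k] unfolding lT_def by blast
    moreover have "add_subgroup (W + lT)"
      using W by (blast intro: add_subgroup_plus ideal_add_subgroup lT)
    moreover have "I \<subseteq> W + lT" unfolding I_def using W by (intro set_plus_mono2) auto
    ultimately have "measure_pmf.prob \<nu> {t. t - a \<in> W + lT} \<le> 1 - \<epsilon> I"
      using nu Ical unfolding eps_balanced_def quot_balanced_def by blast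
    moreover have "measure_pmf.prob \<nu> {t. t - a \<in> W} \<le> measure_pmf.prob \<nu> {t. t - a \<in> W + lT}"
      using ideal_subset_plus[OF lT, of W] by (intro measure_pmf.finite_measure_mono) auto
    ultimately show "measure_pmf.prob \<nu> {t. t - a \<in> W} \<le> 1 - e" by (simp add: e_def)
  qed
  then show thesis using eps Ical by (intro that[of e]) (auto simp: e_def)
qed

lemma quot_balanced_prime:
  fixes \<epsilon> :: "'a set \<Rightarrow> real"
  assumes "\<forall>I\<in>Ical. \<epsilon> I > 0"
  obtains e where "0 < e" "e < 1" "\<And>\<nu>. eps_balanced \<epsilon> \<nu> \<Longrightarrow> quot_balanced p e \<nu>"
  using quot_balanced_pow[OF assms, of 1] unfolding ideal_pow_1[OF ideal] by auto

end


section \<open>Anticoncentration of linear forms\<close>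

definition anticoncentrated :: "('a::comm_ring_1 \<Rightarrow> 'a pmf \<Rightarrow> bool) \<Rightarrow> real \<Rightarrow> nat \<Rightarrow> bool" where
  "anticoncentrated Q \<delta> s \<longleftrightarrow> (\<forall>A (a :: nat \<Rightarrow> 'a) \<mu> d x.
     finite A \<and> s \<le> card A \<and> (\<forall>i\<in>A. Q (a i) (\<mu> i)) \<longrightarrow>
     measure_pmf.prob (Pi_pmf A d \<mu>) {X. (\<Sum>i\<in>A. a i * X i) = x} \<le> \<delta>)"

lemma anticoncentratedI:
  assumes "\<And>A (a :: nat \<Rightarrow> 'a::comm_ring_1) \<mu> d x.
    finite A \<Longrightarrow> s \<le> card A \<Longrightarrow> (\<And>i. i \<in> A \<Longrightarrow> Q (a i) (\<mu> i)) \<Longrightarrow>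
    measure_pmf.prob (Pi_pmf A d \<mu>) {X. (\<Sum>i\<in>A. a i * X i) = x} \<le> \<delta>"
  shows "anticoncentrated Q \<delta> s"
  unfolding anticoncentrated_def by (simp add: assms)

lemma anticoncentratedD:
  fixes A :: "nat set"
  assumes "anticoncentrated Q \<delta> s" "finite A" "s \<le> card A" "\<And>i. i \<in> A \<Longrightarrow> Q (a i) (\<mu> i)"
  shows "measure_pmf.prob (Pi_pmf A d \<mu>) {X. (\<Sum>i\<in>A. a i * X i) = x} \<le> \<delta>"
  using assms by (simp add: anticoncentrated_def)

lemma prob_Pi_pmf_insert_le:
  assumes B: "finite B" "i \<notin> B" and "0 \<le> c"
    and slice: "\<And>y. measure_pmf.prob (Pi_pmf B d \<mu>) {X. X(i := y) \<in> E} \<le> c"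
    and last: "\<And>X y. X(i := y) \<in> E \<Longrightarrow> y \<in> G"
  shows "measure_pmf.prob (Pi_pmf (insert i B) d \<mu>) E \<le> c * measure_pmf.prob (\<mu> i) G"
proof -
  have "Pi_pmf (insert i B) d \<mu> = bind_pmf (\<mu> i) (\<lambda>y. map_pmf (\<lambda>X. X(i := y)) (Pi_pmf B d \<mu>))"
    by (simp add: Pi_pmf_insert'[OF B] map_pmf_def)
  also have "measure_pmf.prob \<dots> E \<le> c * measure_pmf.prob (\<mu> i) G"
  proof (rule prob_bind_pmf_le[OF _ _ \<open>0 \<le> c\<close>])
    show "measure_pmf.prob (map_pmf (\<lambda>X. X(i := y)) (Pi_pmf B d \<mu>)) E \<le> c" for y
      using slice[of y] by (simp add: vimage_def)
    fix y assume "y \<notin> G"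
    then have "{X. X(i := y) \<in> E} = {}" using last by blast
    then show "measure_pmf.prob (map_pmf (\<lambda>X. X(i := y)) (Pi_pmf B d \<mu>)) E = 0"
      by (simp add: vimage_def)
  qed
  finally show ?thesis .
qed

lemma many_values_or_large_fibre:
  assumes A: "finite A" "L * s < card A"
  obtains (many_values) B where "B \<subseteq> A" "card B = L" "inj_on f B"
  | (large_fibre) k where "s \<le> card {i \<in> A. f i = k}"
proof (cases "L \<le> card (f ` A)")
  case True
  then obtain V where V: "V \<subseteq> f ` A" "card V = L" by (meson obtain_subset_with_card_n)
  then obtain B where B: "B \<subseteq> A" "inj_on f B" "V = f ` B" unfolding subset_image_inj by blast
  then have "card B = L" using V(2) by (simp add: card_image)
  with B show thesis by (intro many_values)
next
  case False
  have "\<exists>k. s \<le> card {i \<in> A. f i = k}"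
  proof (rule ccontr)
    assume "\<not> ?thesis"
    then have small: "card {i \<in> A. f i = k} \<le> s" for k by (meson linear)
    have "card A = (\<Sum>k\<in>f ` A. card {i \<in> A. f i = k})"
      using sum.image_gen[OF A(1), of "\<lambda>_. 1::nat" f] by simp
    also have "\<dots> \<le> card (f ` A) * s" using sum_bounded_above[of "f ` A" _ s] small by simp
    also have "\<dots> \<le> L * s" using False by (intro mult_right_mono) auto
    finally show False using A(2) by simp
  qed
  then show thesis using large_fibre by blast
qed

context finite_residue_prime
begin

lemma prob_residue_class_le:
  assumes "quot_balanced p e \<nu>"
  shows "measure_pmf.prob \<nu> {t. t - a \<in> p} \<le> 1 - e"
proof -
  have "p \<noteq> UNIV" using one_notin by blast
  then show ?thesis
    using assms ideal_add_subgroup[OF ideal] unfolding quot_balanced_def by blast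
qed

lemma pmf_le:
  assumes "quot_balanced p e \<nu>"
  shows "pmf \<nu> x \<le> 1 - e"
proof -
  have "pmf \<nu> x = measure_pmf.prob \<nu> {x}" by (simp add: measure_pmf_single)
  also have "\<dots> \<le> measure_pmf.prob \<nu> {t. t - x \<in> p}"
    using ideal_zero[OF ideal] by (intro measure_pmf.finite_measure_mono) auto
  also have "\<dots> \<le> 1 - e" using assms by (rule prob_residue_class_le)
  finally show ?thesis .
qed

lemma prob_mult_mod_pow_le:
  assumes bal: "quot_balanced p e \<nu>" and "a \<noteq> 0" and "e \<le> 1"
  shows "measure_pmf.prob \<nu> {y. a * y - x \<in> ideal_pow p (Suc (val a))} \<le> 1 - e"
proof (cases "\<exists>y0. a * y0 - x \<in> ideal_pow p (Suc (val a))")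
  case False
  then show ?thesis using \<open>e \<le> 1\<close> by simp
next
  case True
  then obtain y0 where y0: "a * y0 - x \<in> ideal_pow p (Suc (val a))" by blast
  have "{y. a * y - x \<in> ideal_pow p (Suc (val a))} \<subseteq> {y. y - y0 \<in> p}"
  proof
    fix y assume "y \<in> {y. a * y - x \<in> ideal_pow p (Suc (val a))}"
    then have "(a * y - x) - (a * y0 - x) \<in> ideal_pow p (Suc (val a))"
      using y0 ideal_diff[OF is_ideal_ideal_pow] by blast
    then have "a * (y - y0) \<in> ideal_pow p (val a + 1)" by (simp add: right_diff_distrib)
    then have "y - y0 \<in> ideal_pow p 1" by (rule pow_cancel[OF \<open>a \<noteq> 0\<close>])
    then show "y \<in> {y. y - y0 \<in> p}" unfolding ideal_pow_1[OF ideal] by simp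
  qed
  then have "measure_pmf.prob \<nu> {y. a * y - x \<in> ideal_pow p (Suc (val a))}
      \<le> measure_pmf.prob \<nu> {y. y - y0 \<in> p}"
    by (intro measure_pmf.finite_measure_mono) auto
  also have "\<dots> \<le> 1 - e" using bal by (rule prob_residue_class_le)
  finally show ?thesis .
qed

lemma prob_linear_form_insert_le:
  fixes a :: "'i \<Rightarrow> 'a"
  assumes B: "finite B" "i \<notin> B" and i: "a i \<noteq> 0" "quot_balanced p e (\<mu> i)" and e: "e \<le> 1"
    and above: "\<And>j. j \<in> B \<Longrightarrow> a j \<in> ideal_pow p (Suc (val (a i)))" and "0 \<le> c"
    and bound: "\<And>x. measure_pmf.prob (Pi_pmf B d \<mu>) {X. (\<Sum>j\<in>B. a j * X j) = x} \<le> c"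
  shows "measure_pmf.prob (Pi_pmf (insert i B) d \<mu>) {X. (\<Sum>j\<in>insert i B. a j * X j) = x}
    \<le> c * (1 - e)"
proof -
  have sum_upd: "(\<Sum>j\<in>insert i B. a j * (X(i := y)) j) = a i * y + (\<Sum>j\<in>B. a j * X j)" for X y
  proof -
    have "(\<Sum>j\<in>B. a j * (X(i := y)) j) = (\<Sum>j\<in>B. a j * X j)"
      using B(2) by (intro sum.cong) auto
    then show ?thesis using B by simp
  qed
  have tail: "(\<Sum>j\<in>B. a j * X j) \<in> ideal_pow p (Suc (val (a i)))" for X
    by (intro ideal_sum[OF is_ideal_ideal_pow] ideal_mult_right[OF is_ideal_ideal_pow] above)
  have "measure_pmf.prob (Pi_pmf (insert i B) d \<mu>) {X. (\<Sum>j\<in>insert i B. a j * X j) = x}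
    \<le> c * measure_pmf.prob (\<mu> i) {y. a i * y - x \<in> ideal_pow p (Suc (val (a i)))}"
  proof (rule prob_Pi_pmf_insert_le[OF B \<open>0 \<le> c\<close>])
    show "measure_pmf.prob (Pi_pmf B d \<mu>)
        {X. X(i := y) \<in> {X. (\<Sum>j\<in>insert i B. a j * X j) = x}} \<le> c" for y
    proof -
      have "{X. X(i := y) \<in> {X. (\<Sum>j\<in>insert i B. a j * X j) = x}}
          = {X. (\<Sum>j\<in>B. a j * X j) = x - a i * y}"
        unfolding mem_Collect_eq sum_upd by (auto simp: eq_diff_eq add.commute)
      then show ?thesis using bound[of "x - a i * y"] by simp
    qed
    fix X y assume "X(i := y) \<in> {X. (\<Sum>j\<in>insert i B. a j * X j) = x}"
    then have "a i * y - x = - (\<Sum>j\<in>B. a j * X j)" unfolding mem_Collect_eq sum_upd by auto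
    then show "y \<in> {y. a i * y - x \<in> ideal_pow p (Suc (val (a i)))}"
      using ideal_minus[OF is_ideal_ideal_pow tail[of X]] by simp
  qed
  also have "\<dots> \<le> c * (1 - e)"
    using i e \<open>0 \<le> c\<close> by (intro mult_left_mono prob_mult_mod_pow_le)
  finally show ?thesis .
qed

lemma prob_linear_form_distinct_val:
  fixes a :: "'i \<Rightarrow> 'a"
  assumes "finite B" "inj_on (\<lambda>i. val (a i)) B" "\<And>i. i \<in> B \<Longrightarrow> a i \<noteq> 0"
    and "\<And>i. i \<in> B \<Longrightarrow> quot_balanced p e (\<mu> i)" and e: "0 \<le> e" "e \<le> 1"
  shows "measure_pmf.prob (Pi_pmf B d \<mu>) {X. (\<Sum>i\<in>B. a i * X i) = x} \<le> (1 - e) ^ card B"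
  using assms(1-4)
proof (induction B arbitrary: x rule: finite_ranking_induct[where f = "\<lambda>i. - int (val (a i))"])
  case empty
  then show ?case by simp
next
  case (insert i B)
  show ?case
  proof (cases "i \<in> B")
    case True
    then show ?thesis using insert.IH insert.prems by (simp add: insert_absorb)
  next
    case False
    have "measure_pmf.prob (Pi_pmf (insert i B) d \<mu>) {X. (\<Sum>j\<in>insert i B. a j * X j) = x}
      \<le> (1 - e) ^ card B * (1 - e)"
    proof (rule prob_linear_form_insert_le[OF insert.hyps(1) False])
      fix j assume j: "j \<in> B"
      then have "val (a i) \<noteq> val (a j)" using insert.prems(1) False by (auto simp: inj_on_def)
      then have "Suc (val (a i)) \<le> val (a j)" using insert.hyps(2)[OF j] by simp
      then show "a j \<in> ideal_pow p (Suc (val (a i)))"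
        using insert.prems(2)[of j] j by (simp add: mem_pow_iff_val)
    qed (use insert.IH insert.prems e in auto)
    then show ?thesis using False insert.hyps(1) by (simp add: mult.commute)
  qed
qed

lemma linear_form_same_val:
  assumes "\<And>i. i \<in> B \<Longrightarrow> a i \<noteq> 0 \<and> val (a i) = k"
  obtains y where "\<And>i. i \<in> B \<Longrightarrow> y i \<notin> p"
    "\<And>X. \<tau> ^ k * (\<Sum>i\<in>B. a i * X i) = \<pi> ^ k * (\<Sum>i\<in>B. y i * X i)"
proof -
  have "\<exists>y. y \<notin> p \<and> \<tau> ^ k * a i = \<pi> ^ k * y" if "i \<in> B" for i
    using unit_part[of "a i"] assms[OF that] by metis
  then obtain y where y: "\<And>i. i \<in> B \<Longrightarrow> y i \<notin> p" "\<And>i. i \<in> B \<Longrightarrow> \<tau> ^ k * a i = \<pi> ^ k * y i"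
    by metis
  have "\<tau> ^ k * (\<Sum>i\<in>B. a i * X i) = \<pi> ^ k * (\<Sum>i\<in>B. y i * X i)" for X
    unfolding sum_distrib_left by (intro sum.cong refl) (simp add: y(2) flip: mult.assoc)
  with y(1) show thesis by (rule that)
qed

lemma prob_unit_form_class_le:
  fixes \<epsilon> :: "'a set \<Rightarrow> real"
  assumes eps: "\<forall>I\<in>Ical. \<epsilon> I > 0" and delta: "0 < \<delta>"
  obtains s m where "\<And>B (y :: 'i \<Rightarrow> 'a) \<mu> d z. finite B \<Longrightarrow> s \<le> card B \<Longrightarrow>
      (\<And>i. i \<in> B \<Longrightarrow> y i \<notin> p \<and> eps_balanced \<epsilon> (\<mu> i)) \<Longrightarrow>
    measure_pmf.prob (Pi_pmf B d \<mu>) {X. (\<Sum>i\<in>B. y i * X i) \<in> residue_class (ideal_pow p m) z} \<le> \<delta>"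
proof -
  obtain m where m: "inverse (real (Suc m)) < \<delta> / 2"
    using reals_Archimedean[of "\<delta> / 2"] delta by auto
  define J where "J = ideal_pow p (Suc m)"
  interpret finite_index_subgroup J unfolding J_def by (rule finite_index_pow)
  obtain e where e: "0 < e" "e < 1" and bal: "\<And>\<nu>. eps_balanced \<epsilon> \<nu> \<Longrightarrow> quot_balanced J e \<nu>"
    using quot_balanced_pow[OF eps, of "Suc m"] unfolding J_def by blast
  have "1 / card (quot J) \<le> inverse (real (Suc m))"
    using card_quot_pow[of "Suc m"] by (simp add: J_def inverse_eq_divide frac_le)
  then have card_quot: "1 / card (quot J) + \<delta> / 2 \<le> \<delta>" using m by linarith
  have "e \<le> 1" "0 < \<delta> / 2" using e delta by auto
  then obtain s where s: "\<And>B (f :: 'i \<Rightarrow> 'a \<Rightarrow> 'a) d \<mu> z. finite B \<Longrightarrow> s \<le> card B \<Longrightarrow>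
      (\<And>i. i \<in> B \<Longrightarrow> quot_balanced J e (map_pmf (f i) (\<mu> i))) \<Longrightarrow>
      sum_class_prob f d \<mu> B z \<le> 1 / card (quot J) + \<delta> / 2"
    using sum_class_equidistribution[OF e(1)] by blast
  show thesis
  proof (rule that[of s "Suc m"])
    fix B and y :: "'i \<Rightarrow> 'a" and \<mu> d z
    assume B: "finite B" "s \<le> card B"
      and y: "\<And>i. i \<in> B \<Longrightarrow> y i \<notin> p \<and> eps_balanced \<epsilon> (\<mu> i)"
    have "quot_balanced J e (map_pmf ((*) (y i)) (\<mu> i))" if i: "i \<in> B" for i
    proof -
      obtain r where "1 - y i * r \<in> J" unfolding J_def using inverse_mod_pow y[OF i] by blast
      then show ?thesis
        using y[OF i] bal e(2) is_ideal_ideal_pow unfolding J_def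
        by (intro quot_balanced_mult_unit) auto
    qed
    with B have "sum_class_prob (\<lambda>i. (*) (y i)) d \<mu> B z \<le> 1 / card (quot J) + \<delta> / 2" by (rule s)
    then have "sum_class_prob (\<lambda>i. (*) (y i)) d \<mu> B z \<le> \<delta>" using card_quot by linarith
    then show "measure_pmf.prob (Pi_pmf B d \<mu>)
        {X. (\<Sum>i\<in>B. y i * X i) \<in> residue_class (ideal_pow p (Suc m)) z} \<le> \<delta>"
      unfolding sum_class_prob_def by (simp only: J_def)
  qed
qed

lemma anticoncentrated_same_val:
  fixes \<epsilon> :: "'a set \<Rightarrow> real"
  assumes eps: "\<forall>I\<in>Ical. \<epsilon> I > 0" and delta: "0 < \<delta>"
  obtains s where "\<And>k. anticoncentrated (\<lambda>a \<nu>. a \<noteq> 0 \<and> val a = k \<and> eps_balanced \<epsilon> \<nu>) \<delta> s"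
proof -
  obtain s m where equidistributed: "\<And>B (y :: nat \<Rightarrow> 'a) \<mu> d z. finite B \<Longrightarrow> s \<le> card B \<Longrightarrow>
      (\<And>i. i \<in> B \<Longrightarrow> y i \<notin> p \<and> eps_balanced \<epsilon> (\<mu> i)) \<Longrightarrow>
    measure_pmf.prob (Pi_pmf B d \<mu>) {X. (\<Sum>i\<in>B. y i * X i) \<in> residue_class (ideal_pow p m) z} \<le> \<delta>"
    using prob_unit_form_class_le[OF assms] by blast
  show thesis
  proof (rule that[of s], rule anticoncentratedI)
    fix k B and a :: "nat \<Rightarrow> 'a" and \<mu> d x
    assume B: "finite B" "s \<le> card B"
      and a: "\<And>i. i \<in> B \<Longrightarrow> a i \<noteq> 0 \<and> val (a i) = k \<and> eps_balanced \<epsilon> (\<mu> i)"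
    obtain y where y: "\<And>i. i \<in> B \<Longrightarrow> y i \<notin> p"
      and scale: "\<And>X. \<tau> ^ k * (\<Sum>i\<in>B. a i * X i) = \<pi> ^ k * (\<Sum>i\<in>B. y i * X i)"
      using linear_form_same_val[of B a k] a by blast
    show "measure_pmf.prob (Pi_pmf B d \<mu>) {X. (\<Sum>i\<in>B. a i * X i) = x} \<le> \<delta>"
    proof (cases "\<exists>X0. (\<Sum>i\<in>B. a i * X0 i) = x")
      case True
      then obtain X0 where X0: "(\<Sum>i\<in>B. a i * X0 i) = x" by blast
      define z where "z = (\<Sum>i\<in>B. y i * X0 i)"
      have "(\<Sum>i\<in>B. y i * X i) = z" if "(\<Sum>i\<in>B. a i * X i) = x" for X
        using scale[of X] scale[of X0] X0 that pi_nonzero by (simp add: z_def)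
      then have "measure_pmf.prob (Pi_pmf B d \<mu>) {X. (\<Sum>i\<in>B. a i * X i) = x}
          \<le> measure_pmf.prob (Pi_pmf B d \<mu>)
              {X. (\<Sum>i\<in>B. y i * X i) \<in> residue_class (ideal_pow p m) z}"
        using mem_residue_class_self[OF ideal_add_subgroup[OF is_ideal_ideal_pow]]
        by (intro measure_pmf.finite_measure_mono) auto
      also have "\<dots> \<le> \<delta>" using B y a by (intro equidistributed) auto
      finally show ?thesis .
    next
      case False
      then show ?thesis using delta by simp
    qed
  qed
qed

text \<open>Either the coefficients take many valuations, and reducing modulo successive powers of \<open>p\<close>
  costs a factor \<open>1 - e\<close> for each of them, or one valuation occurs many times, and the
  corresponding partial sum equidistributes modulo a high power of \<open>p\<close>.\<close>
lemma anticoncentrated_eps_balanced: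
  fixes \<epsilon> :: "'a set \<Rightarrow> real"
  assumes eps: "\<forall>I\<in>Ical. \<epsilon> I > 0" and delta: "0 < \<delta>"
  obtains s where "anticoncentrated (\<lambda>a \<nu>. a \<noteq> 0 \<and> eps_balanced \<epsilon> \<nu>) \<delta> s"
proof -
  obtain e where e: "0 < e" "e < 1" and bal: "\<And>\<nu>. eps_balanced \<epsilon> \<nu> \<Longrightarrow> quot_balanced p e \<nu>"
    using quot_balanced_prime[OF eps] by blast
  obtain L where L: "(1 - e) ^ L < \<delta>"
    using real_arch_pow_inv[of \<delta> "1 - e"] delta e by auto
  obtain s where same_val:
    "\<And>k. anticoncentrated (\<lambda>a \<nu>. a \<noteq> 0 \<and> val a = k \<and> eps_balanced \<epsilon> \<nu>) \<delta> s"
    using anticoncentrated_same_val[OF assms] by blast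
  show thesis
  proof (rule that[of "Suc (L * s)"], rule anticoncentratedI)
    fix A and a :: "nat \<Rightarrow> 'a" and \<mu> d x
    assume A: "finite A" "Suc (L * s) \<le> card A"
      and a: "\<And>i. i \<in> A \<Longrightarrow> a i \<noteq> 0 \<and> eps_balanced \<epsilon> (\<mu> i)"
    obtain B where "B \<subseteq> A"
      and B: "\<And>x. measure_pmf.prob (Pi_pmf B d \<mu>) {X. (\<Sum>i\<in>B. a i * X i) = x} \<le> \<delta>"
      using A(1) A(2)[THEN Suc_le_lessD]
    proof (cases rule: many_values_or_large_fibre[where f = "\<lambda>i. val (a i)"])
      case (many_values B)
      then have "measure_pmf.prob (Pi_pmf B d \<mu>) {X. (\<Sum>i\<in>B. a i * X i) = x} \<le> \<delta>" for x
        using prob_linear_form_distinct_val[of B a e \<mu> d x] a bal e L A(1) finite_subset[of B A]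
        by force
      with many_values(1) show thesis by (rule that)
    next
      case (large_fibre k)
      have "measure_pmf.prob (Pi_pmf {i \<in> A. val (a i) = k} d \<mu>)
          {X. (\<Sum>i\<in>{i \<in> A. val (a i) = k}. a i * X i) = x} \<le> \<delta>" for x
        using A(1) large_fibre a by (intro anticoncentratedD[OF same_val[of k]]) auto
      then show thesis by (rule that[rotated]) simp
    qed
    from prob_linear_form_subset_le[OF A(1) \<open>B \<subseteq> A\<close> _ B] delta
    show "measure_pmf.prob (Pi_pmf A d \<mu>) {X. (\<Sum>i\<in>A. a i * X i) = x} \<le> \<delta>" by simp
  qed
qed

end


section \<open>Singularity of random matrices\<close>

definition dependent_column :: "nat \<Rightarrow> nat \<Rightarrow> (nat \<times> nat \<Rightarrow> 'a::comm_ring_1) set" where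
  "dependent_column n j = {M. (\<lambda>i. M (i, j)) \<in> fraction_span {..<n} {..<j} (\<lambda>c i. M (i, c))}"

definition dependent_row :: "nat \<Rightarrow> nat set \<Rightarrow> nat \<Rightarrow> (nat \<times> nat \<Rightarrow> 'a::comm_ring_1) set" where
  "dependent_row k R i = {M. (\<lambda>c. M (i, c)) \<in> fraction_span {..<k} R (\<lambda>r c. M (r, c))}"

definition sparse_relation :: "nat \<Rightarrow> nat \<Rightarrow> nat \<Rightarrow> (nat \<times> nat \<Rightarrow> 'a::comm_ring_1) set" where
  "sparse_relation n k s = {M. \<exists>F. (\<exists>i<n. F i \<noteq> 0) \<and> card {i. i < n \<and> F i \<noteq> 0} \<le> s \<and>
     (\<forall>c<k. (\<Sum>i<n. F i * M (i, c)) = 0)}"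

lemma sum_bilinear_swap:
  fixes F :: "'i \<Rightarrow> 'a::comm_ring_1"
  shows "(\<Sum>i\<in>A. F i * (\<Sum>c\<in>B. M (i, c) * v c)) = (\<Sum>c\<in>B. (\<Sum>i\<in>A. F i * M (i, c)) * v c)"
  unfolding sum_distrib_left sum_distrib_right by (subst sum.swap) (simp add: mult.assoc)

lemma det_eq_0_imp_dependent_column:
  fixes M :: "nat \<times> nat \<Rightarrow> 'a::idom"
  assumes "det (mat n n M) = 0"
  obtains j where "j < n" "M \<in> dependent_column n j"
proof -
  obtain v where v: "v \<in> carrier_vec n" "v \<noteq> 0\<^sub>v n" "mat n n M *\<^sub>v v = 0\<^sub>v n"
    using assms det_0_iff_vec_prod_zero[of "mat n n M" n] by auto
  have kernel: "(\<Sum>c<n. M (i, c) * v $ c) = 0" if "i < n" for i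
  proof -
    have "(\<Sum>c<n. M (i, c) * v $ c) = (mat n n M *\<^sub>v v) $ i"
      using that v(1) by (simp add: scalar_prod_def lessThan_atLeast0)
    then show ?thesis using that by (simp add: v(3))
  qed
  from v(1,2) obtain c where "c < n \<and> v $ c \<noteq> 0" by (metis carrier_vecD eq_vecI index_zero_vec)
  then obtain j where j: "j < n" "v $ j \<noteq> 0" "\<And>c. c < n \<Longrightarrow> v $ c \<noteq> 0 \<Longrightarrow> c \<le> j"
    using ex_has_greatest_nat[of "\<lambda>c. c < n \<and> v $ c \<noteq> 0" c "\<lambda>c. c" n] by blast
  have "(\<Sum>i<n. F i * M (i, j)) = 0" if F: "\<forall>c\<in>{..<j}. (\<Sum>i<n. F i * M (i, c)) = 0" for F
  proof -
    have "0 = (\<Sum>i<n. F i * (\<Sum>c<n. M (i, c) * v $ c))" using kernel by simp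
    also have "\<dots> = (\<Sum>c<n. (\<Sum>i<n. F i * M (i, c)) * v $ c)" by (rule sum_bilinear_swap)
    also have "\<dots> = (\<Sum>c\<in>{j}. (\<Sum>i<n. F i * M (i, c)) * v $ c)"
    proof (rule sum.mono_neutral_right)
      show "\<forall>c\<in>{..<n} - {j}. (\<Sum>i<n. F i * M (i, c)) * v $ c = 0"
      proof
        fix c assume c: "c \<in> {..<n} - {j}"
        show "(\<Sum>i<n. F i * M (i, c)) * v $ c = 0"
        proof (cases "c < j")
          case False
          then have "v $ c = 0" using c j(3)[of c] by auto
          then show ?thesis by simp
        qed (use F in simp)
      qed
    qed (use j(1) in auto)
    finally show ?thesis using j(2) by simp
  qed
  then have "M \<in> dependent_column n j"
    unfolding dependent_column_def fraction_span_def by blast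
  with j(1) show thesis by (rule that)
qed

lemma prob_dependent_column_le:
  fixes \<mu> :: "nat \<times> nat \<Rightarrow> 'a::idom pmf"
  assumes q: "0 \<le> q" "q \<le> 1" and j: "j < m"
    and atoms: "\<And>z x. z \<in> {..<n} \<times> {..<m} \<Longrightarrow> pmf (\<mu> z) x \<le> q"
  shows "measure_pmf.prob (Pi_pmf ({..<n} \<times> {..<m}) d \<mu>) (dependent_column n j) \<le> q ^ (n - j)"
  unfolding dependent_column_def
proof (rule prob_slice_le[where I = "{..<n}" and g = "\<lambda>i. (i, j)"
      and Q = "\<lambda>X M. X \<in> fraction_span {..<n} {..<j} (\<lambda>c i. M (i, c))"])
  fix M :: "nat \<times> nat \<Rightarrow> 'a"
  have "measure_pmf.prob (Pi_pmf {..<n} d (\<lambda>i. \<mu> (i, j)))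
      (fraction_span {..<n} {..<j} (\<lambda>c i. M (i, c))) \<le> q ^ (card {..<n} - card {..<j})"
    using j atoms q by (intro prob_fraction_span_le) auto
  then show "measure_pmf.prob (Pi_pmf {..<n} d (\<lambda>i. \<mu> (i, j)))
      {X. X \<in> fraction_span {..<n} {..<j} (\<lambda>c i. M (i, c))} \<le> q ^ (n - j)"
    by simp
next
  fix X X' and M M' :: "nat \<times> nat \<Rightarrow> 'a"
  assume "X \<in> fraction_span {..<n} {..<j} (\<lambda>c i. M (i, c))" and agree: "\<forall>i\<in>{..<n}. X i = X' i"
    "\<forall>z. z \<notin> (\<lambda>i. (i, j)) ` {..<n} \<longrightarrow> M z = M' z"
  moreover have "X \<in> fraction_span {..<n} {..<j} (\<lambda>c i. M (i, c)) \<longleftrightarrow>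
      X' \<in> fraction_span {..<n} {..<j} (\<lambda>c i. M' (i, c))"
    by (intro fraction_span_cong agree[rule_format]) auto
  ultimately show "X' \<in> fraction_span {..<n} {..<j} (\<lambda>c i. M' (i, c))" by blast
qed (use q j in \<open>auto simp: inj_on_def\<close>)

lemma prob_dependent_row_le:
  fixes \<mu> :: "nat \<times> nat \<Rightarrow> 'a::idom pmf"
  assumes q: "0 \<le> q" "q \<le> 1" and "k \<le> m" "i < n" and R: "finite R" "i \<notin> R"
    and atoms: "\<And>z x. z \<in> {..<n} \<times> {..<m} \<Longrightarrow> pmf (\<mu> z) x \<le> q"
  shows "measure_pmf.prob (Pi_pmf ({..<n} \<times> {..<m}) d \<mu>) (dependent_row k R i) \<le> q ^ (k - card R)"
  unfolding dependent_row_def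
proof (rule prob_slice_le[where I = "{..<k}" and g = "Pair i"
      and Q = "\<lambda>X M. X \<in> fraction_span {..<k} R (\<lambda>r c. M (r, c))"])
  fix M :: "nat \<times> nat \<Rightarrow> 'a"
  have "measure_pmf.prob (Pi_pmf {..<k} d (\<lambda>c. \<mu> (i, c)))
      (fraction_span {..<k} R (\<lambda>r c. M (r, c))) \<le> q ^ (card {..<k} - card R)"
    using assms by (intro prob_fraction_span_le) auto
  then show "measure_pmf.prob (Pi_pmf {..<k} d (\<lambda>c. \<mu> (i, c)))
      {X. X \<in> fraction_span {..<k} R (\<lambda>r c. M (r, c))} \<le> q ^ (k - card R)"
    by simp
next
  fix X X' and M M' :: "nat \<times> nat \<Rightarrow> 'a"
  assume "X \<in> fraction_span {..<k} R (\<lambda>r c. M (r, c))" and agree: "\<forall>c\<in>{..<k}. X c = X' c"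
    "\<forall>z. z \<notin> Pair i ` {..<k} \<longrightarrow> M z = M' z"
  moreover have "X \<in> fraction_span {..<k} R (\<lambda>r c. M (r, c)) \<longleftrightarrow>
      X' \<in> fraction_span {..<k} R (\<lambda>r c. M' (r, c))"
    using R(2) by (intro fraction_span_cong agree[rule_format]) auto
  ultimately show "X' \<in> fraction_span {..<k} R (\<lambda>r c. M' (r, c))" by blast
qed (use assms in \<open>auto simp: inj_on_def\<close>)

text \<open>\<open>g\<close> lists the support of a sparse relation, possibly with repetitions.\<close>
lemma sparse_relation_imp_dependent_row:
  fixes M :: "nat \<times> nat \<Rightarrow> 'a::idom"
  assumes "M \<in> sparse_relation n k s"
  obtains g a where "g \<in> {..<s} \<rightarrow>\<^sub>E {..<n}" "a < s" "M \<in> dependent_row k (g ` {..<s} - {g a}) (g a)"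
proof -
  from assms obtain F where F: "\<exists>i<n. F i \<noteq> 0" "card {i. i < n \<and> F i \<noteq> 0} \<le> s"
    "\<And>c. c < k \<Longrightarrow> (\<Sum>i<n. F i * M (i, c)) = 0"
    unfolding sparse_relation_def by blast
  define U where "U = {i. i < n \<and> F i \<noteq> 0}"
  have U: "finite U" "U \<noteq> {}" "card U \<le> s" using F(1,2) by (auto simp: U_def)
  have "\<exists>h. inj_on h U \<and> h ` U \<subseteq> {..<s}"
    using U by (subst inj_on_iff_card_le) auto
  then obtain h where h: "h ` {..<s} = U" unfolding inj_on_iff_surj[OF U(2)] by blast
  define g where "g = restrict h {..<s}"
  have g: "g ` {..<s} = U" "g \<in> {..<s} \<rightarrow>\<^sub>E {..<n}" using h by (auto simp: g_def U_def)
  with U(2) obtain a where a: "a < s" "g a \<in> U" by auto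
  have "(\<Sum>c<k. G c * M (g a, c)) = 0"
    if G: "\<forall>r\<in>U - {g a}. (\<Sum>c<k. G c * M (r, c)) = 0" for G
  proof -
    have "F (g a) * (\<Sum>c<k. M (g a, c) * G c) = (\<Sum>i\<in>U. F i * (\<Sum>c<k. M (i, c) * G c))"
      using G U(1) a(2) by (simp add: sum.remove mult.commute[of _ "G _"])
    also have "\<dots> = (\<Sum>i<n. F i * (\<Sum>c<k. M (i, c) * G c))"
      by (rule sum.mono_neutral_left) (auto simp: U_def)
    also have "\<dots> = 0" unfolding sum_bilinear_swap by (simp add: F(3))
    finally show ?thesis using a(2) by (simp add: U_def mult.commute)
  qed
  then have "M \<in> dependent_row k (g ` {..<s} - {g a}) (g a)"
    unfolding dependent_row_def fraction_span_def g(1) by blast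
  with g(2) a(1) show thesis by (rule that)
qed

lemma prob_sparse_relation_le:
  fixes \<mu> :: "nat \<times> nat \<Rightarrow> 'a::idom pmf"
  assumes q: "0 \<le> q" "q \<le> 1" and "k \<le> m"
    and atoms: "\<And>z x. z \<in> {..<n} \<times> {..<m} \<Longrightarrow> pmf (\<mu> z) x \<le> q"
  shows "measure_pmf.prob (Pi_pmf ({..<n} \<times> {..<m}) d \<mu>) (sparse_relation n k s)
    \<le> real s * real n ^ s * q ^ (k - s)"
proof -
  let ?law = "Pi_pmf ({..<n} \<times> {..<m}) d \<mu>"
  define Z where "Z = ({..<s} \<rightarrow>\<^sub>E {..<n}) \<times> {..<s}"
  define D where "D = (\<lambda>(g, a). dependent_row k (g ` {..<s} - {g a}) (g a) :: (nat \<times> nat \<Rightarrow> 'a) set)"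
  have Z: "finite Z" "card Z = s * n ^ s"
    by (auto simp: Z_def card_PiE card_cartesian_product intro: finite_PiE)
  have prob_D_le: "measure_pmf.prob ?law (D z) \<le> q ^ (k - s)" if z: "z \<in> Z" for z
  proof -
    obtain g a where ga: "z = (g, a)" "g \<in> {..<s} \<rightarrow>\<^sub>E {..<n}" "a < s" using z by (auto simp: Z_def)
    define R where "R = g ` {..<s} - {g a}"
    have prob_row_le: "measure_pmf.prob ?law (D z) \<le> q ^ (k - card R)"
      unfolding D_def ga(1) prod.case R_def using ga PiE_mem[OF ga(2), of a]
      by (intro prob_dependent_row_le q \<open>k \<le> m\<close> atoms) auto
    have "card R \<le> s"
      using card_mono[of "g ` {..<s}" R] card_image_le[of "{..<s}" g] by (simp add: R_def)
    then have "q ^ (k - card R) \<le> q ^ (k - s)" using q by (intro power_decreasing) auto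
    with prob_row_le show ?thesis by (rule order_trans)
  qed
  have "measure_pmf.prob ?law (sparse_relation n k s) \<le> measure_pmf.prob ?law (\<Union>z\<in>Z. D z)"
  proof (intro measure_pmf.finite_measure_mono subsetI)
    fix M :: "nat \<times> nat \<Rightarrow> 'a" assume "M \<in> sparse_relation n k s"
    then obtain g a where "g \<in> {..<s} \<rightarrow>\<^sub>E {..<n}" "a < s"
      "M \<in> dependent_row k (g ` {..<s} - {g a}) (g a)"
      by (rule sparse_relation_imp_dependent_row)
    then show "M \<in> (\<Union>z\<in>Z. D z)" unfolding Z_def D_def by (intro UN_I[of "(g, a)"]) auto
  qed simp
  also have "\<dots> \<le> (\<Sum>z\<in>Z. measure_pmf.prob ?law (D z))"
    using Z(1) by (intro measure_pmf.finite_measure_subadditive_finite) auto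
  also have "\<dots> \<le> real (card Z) * q ^ (k - s)"
    using prob_D_le by (intro sum_bounded_above) auto
  finally show ?thesis by (simp add: Z(2))
qed

lemma sparse_relation_cong:
  assumes "\<And>i c. i < n \<Longrightarrow> c < k \<Longrightarrow> M (i, c) = M' (i, c)"
  shows "M \<in> sparse_relation n k s \<longleftrightarrow> M' \<in> sparse_relation n k s"
  unfolding sparse_relation_def using assms by simp

text \<open>A column in the span of the previous ones is annihilated by every linear form that annihilates
  them, and unless there is a sparse relation such a form can be chosen with many nonzero
  coefficients.\<close>
lemma prob_dependent_column_dense_le:
  fixes \<mu> :: "nat \<times> nat \<Rightarrow> 'a::idom pmf"
  assumes j: "k \<le> j" "j < n" "j < m" and delta: "0 \<le> \<delta>"
    and anti: "\<And>A (a :: nat \<Rightarrow> 'a) x. A \<subseteq> {..<n} \<Longrightarrow> s \<le> card A \<Longrightarrow> \<forall>i\<in>A. a i \<noteq> 0 \<Longrightarrow>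
      measure_pmf.prob (Pi_pmf A d (\<lambda>i. \<mu> (i, j))) {X. (\<Sum>i\<in>A. a i * X i) = x} \<le> \<delta>"
  shows "measure_pmf.prob (Pi_pmf ({..<n} \<times> {..<m}) d \<mu>)
    (dependent_column n j - sparse_relation n k s) \<le> \<delta>"
proof -
  define Q where "Q X M \<longleftrightarrow>
      X \<in> fraction_span {..<n} {..<j} (\<lambda>c i. M (i, c)) \<and> M \<notin> sparse_relation n k s"
    for X and M :: "nat \<times> nat \<Rightarrow> 'a"
  have "measure_pmf.prob (Pi_pmf ({..<n} \<times> {..<m}) d \<mu>) {M. Q (\<lambda>i. M (i, j)) M} \<le> \<delta>"
  proof (rule prob_slice_le[where I = "{..<n}" and g = "\<lambda>i. (i, j)" and Q = Q])
    fix X X' and M M' :: "nat \<times> nat \<Rightarrow> 'a"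
    assume Q: "Q X M" and agree: "\<forall>i\<in>{..<n}. X i = X' i"
      "\<forall>z. z \<notin> (\<lambda>i. (i, j)) ` {..<n} \<longrightarrow> M z = M' z"
    have "X \<in> fraction_span {..<n} {..<j} (\<lambda>c i. M (i, c)) \<longleftrightarrow>
        X' \<in> fraction_span {..<n} {..<j} (\<lambda>c i. M' (i, c))"
      by (intro fraction_span_cong agree[rule_format]) auto
    moreover have "M \<in> sparse_relation n k s \<longleftrightarrow> M' \<in> sparse_relation n k s"
      using j(1) by (intro sparse_relation_cong agree(2)[rule_format]) auto
    ultimately show "Q X' M'" using Q by (simp add: Q_def)
  next
    fix M :: "nat \<times> nat \<Rightarrow> 'a"
    obtain F where F: "\<exists>i\<in>{..<n}. F i \<noteq> 0" "\<forall>c\<in>{..<j}. (\<Sum>i<n. F i * M (i, c)) = 0"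
      using exists_linear_relation[of "{..<j}" "{..<n}" "\<lambda>i c. M (i, c)"] j(2) by auto
    define A where "A = {i. i < n \<and> F i \<noteq> 0}"
    show "measure_pmf.prob (Pi_pmf {..<n} d (\<lambda>i. \<mu> (i, j))) {X. Q X M} \<le> \<delta>"
    proof (cases "card A \<le> s")
      case True
      have "M \<in> sparse_relation n k s"
        unfolding sparse_relation_def using F True j(1)
        by (intro CollectI exI[of _ F]) (auto simp: A_def)
      then show ?thesis using delta by (simp add: Q_def)
    next
      case False
      have "measure_pmf.prob (Pi_pmf {..<n} d (\<lambda>i. \<mu> (i, j))) {X. Q X M}
          \<le> measure_pmf.prob (Pi_pmf {..<n} d (\<lambda>i. \<mu> (i, j))) {X. (\<Sum>i<n. F i * X i) = 0}"
        using F(2) by (intro measure_pmf.finite_measure_mono) (auto simp: Q_def fraction_span_def)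
      also have "\<dots> \<le> \<delta>"
      proof (rule prob_linear_form_subset_le[where B = A])
        show "measure_pmf.prob (Pi_pmf A d (\<lambda>i. \<mu> (i, j))) {X. (\<Sum>i\<in>A. F i * X i) = x} \<le> \<delta>" for x
          using False by (intro anti) (auto simp: A_def)
      qed (use delta in \<open>auto simp: A_def\<close>)
      finally show ?thesis .
    qed
  qed (use delta j in \<open>auto simp: inj_on_def\<close>)
  then show ?thesis by (simp add: Q_def dependent_column_def set_diff_eq)
qed

lemma power_mult_geometric_tendsto_0:
  fixes q :: real
  assumes "0 < q" "q < 1"
  shows "(\<lambda>n. real n ^ k * q ^ n) \<longlonglongrightarrow> 0"
proof (cases "k = 0")
  case True
  then show ?thesis using LIMSEQ_realpow_zero[of q] assms by simp
next
  case False
  define r where "r = root k q"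
  have r: "0 < r" "r < 1" "r ^ k = q" using assms False by (auto simp: r_def)
  have "(\<lambda>n. real n * r ^ n) \<longlonglongrightarrow> 0"
    using r powser_times_n_limit_0[of r] by simp
  then have "(\<lambda>n. (real n * r ^ n) ^ k) \<longlonglongrightarrow> 0 ^ k" by (rule tendsto_power)
  moreover have "(real n * r ^ n) ^ k = real n ^ k * q ^ n" for n
    by (simp add: power_mult_distrib r(3)[symmetric] power_mult[symmetric] mult.commute)
  ultimately show ?thesis using False by (simp add: zero_power)
qed

lemma sum_reversed_powers_le:
  fixes q :: real
  assumes "0 < q" "q < 1"
  shows "(\<Sum>j<k. q ^ (k + L - j)) \<le> q ^ L / (1 - q)"
proof -
  have "(\<Sum>j<k. q ^ (k + L - j)) = (\<Sum>j<k. q ^ Suc L * q ^ (k - Suc j))"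
  proof (rule sum.cong[OF refl])
    fix j assume "j \<in> {..<k}"
    then have "k + L - j = Suc L + (k - Suc j)" by auto
    then show "q ^ (k + L - j) = q ^ Suc L * q ^ (k - Suc j)" by (simp only: power_add)
  qed
  also have "\<dots> = q ^ Suc L * (\<Sum>i<k. q ^ i)"
    unfolding sum_distrib_left by (rule sum.nat_diff_reindex)
  also have "(\<Sum>i<k. q ^ i) = (1 - q ^ k) / (1 - q)"
    using assms sum_gp_strict[of q k] by simp
  also have "q ^ Suc L * ((1 - q ^ k) / (1 - q)) \<le> q ^ L * (1 / (1 - q))"
    using assms by (intro mult_mono power_decreasing divide_right_mono)
      (auto simp: power_le_one zero_le_divide_iff)
  finally show ?thesis by simp
qed

locale anticoncentrated_class =
  fixes \<D> :: "'a::idom pmf set" and q :: real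
  assumes q: "0 < q" "q < 1" and atoms: "\<nu> \<in> \<D> \<Longrightarrow> pmf \<nu> x \<le> q"
    and anticoncentrated: "0 < \<delta> \<Longrightarrow> \<exists>s. anticoncentrated (\<lambda>a \<nu>. a \<noteq> 0 \<and> \<nu> \<in> \<D>) \<delta> s"
begin

lemma prob_det_eq_0_le:
  fixes \<mu> :: "nat \<times> nat \<Rightarrow> 'a pmf"
  assumes n: "n = k + L" "n \<le> m" and mu: "\<And>z. z \<in> {..<n} \<times> {..<m} \<Longrightarrow> \<mu> z \<in> \<D>" and delta: "0 \<le> \<delta>"
    and anti: "anticoncentrated (\<lambda>a \<nu>. a \<noteq> 0 \<and> \<nu> \<in> \<D>) \<delta> s"
  shows "measure_pmf.prob (Pi_pmf ({..<n} \<times> {..<m}) d \<mu>) {M. det (mat n n M) = 0}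
    \<le> q ^ L / (1 - q) + (real s * real n ^ s * q ^ (k - s) + real L * \<delta>)"
proof -
  let ?law = "Pi_pmf ({..<n} \<times> {..<m}) d \<mu>"
  let ?dependent = "dependent_column n :: nat \<Rightarrow> (nat \<times> nat \<Rightarrow> 'a) set"
  let ?sparse = "sparse_relation n k s :: (nat \<times> nat \<Rightarrow> 'a) set"
  have atoms': "pmf (\<mu> z) x \<le> q" if "z \<in> {..<n} \<times> {..<m}" for z x
    using mu[OF that] by (rule atoms)
  have "measure_pmf.prob ?law (\<Union>j<k. ?dependent j) \<le> (\<Sum>j<k. measure_pmf.prob ?law (?dependent j))"
    by (intro measure_pmf.finite_measure_subadditive_finite) auto
  also have "\<dots> \<le> (\<Sum>j<k. q ^ (n - j))"
    using q n atoms' by (intro sum_mono prob_dependent_column_le) auto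
  also have "\<dots> \<le> q ^ L / (1 - q)" unfolding n(1) using q by (rule sum_reversed_powers_le)
  finally have early: "measure_pmf.prob ?law (\<Union>j<k. ?dependent j) \<le> q ^ L / (1 - q)" .
  have sparse: "measure_pmf.prob ?law ?sparse \<le> real s * real n ^ s * q ^ (k - s)"
    using q n atoms' by (intro prob_sparse_relation_le) auto
  have "measure_pmf.prob ?law (\<Union>j\<in>{k..<n}. ?dependent j - ?sparse)
      \<le> (\<Sum>j\<in>{k..<n}. measure_pmf.prob ?law (?dependent j - ?sparse))"
    by (intro measure_pmf.finite_measure_subadditive_finite) auto
  also have "\<dots> \<le> (\<Sum>j\<in>{k..<n}. \<delta>)"
  proof (intro sum_mono prob_dependent_column_dense_le)
    fix j A and a :: "nat \<Rightarrow> 'a" and x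
    assume j: "j \<in> {k..<n}" and A: "A \<subseteq> {..<n}" "s \<le> card A" "\<forall>i\<in>A. a i \<noteq> 0"
    have "\<mu> (i, j) \<in> \<D>" if "i \<in> A" for i using that A(1) j n by (intro mu) auto
    then show "measure_pmf.prob (Pi_pmf A d (\<lambda>i. \<mu> (i, j))) {X. (\<Sum>i\<in>A. a i * X i) = x} \<le> \<delta>"
      using A finite_subset[OF A(1)] by (intro anticoncentratedD[OF anti]) auto
  qed (use delta n in auto)
  also have "\<dots> = real L * \<delta>" by (simp add: n(1))
  finally have late: "measure_pmf.prob ?law (\<Union>j\<in>{k..<n}. ?dependent j - ?sparse) \<le> real L * \<delta>" .
  have "measure_pmf.prob ?law {M. det (mat n n M) = 0}
      \<le> measure_pmf.prob ?law
          ((\<Union>j<k. ?dependent j) \<union> (?sparse \<union> (\<Union>j\<in>{k..<n}. ?dependent j - ?sparse)))"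
  proof (intro measure_pmf.finite_measure_mono subsetI)
    fix M :: "nat \<times> nat \<Rightarrow> 'a" assume "M \<in> {M. det (mat n n M) = 0}"
    then obtain j where "j < n" "M \<in> ?dependent j" by (auto elim: det_eq_0_imp_dependent_column)
    then show "M \<in> (\<Union>j<k. ?dependent j) \<union> (?sparse \<union> (\<Union>j\<in>{k..<n}. ?dependent j - ?sparse))"
      by (cases "j < k") auto
  qed simp
  also have "\<dots> \<le> measure_pmf.prob ?law (\<Union>j<k. ?dependent j)
      + (measure_pmf.prob ?law ?sparse
        + measure_pmf.prob ?law (\<Union>j\<in>{k..<n}. ?dependent j - ?sparse))"
    by (intro order_trans[OF measure_Un_le] add_left_mono measure_Un_le) auto
  finally show ?thesis using early sparse late by linarith
qed

lemma prob_det_eq_0_tendsto_0: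
  fixes \<mu> :: "nat \<Rightarrow> nat \<times> nat \<Rightarrow> 'a pmf"
  assumes m: "\<And>n. n \<le> m n" and mu: "\<And>n z. z \<in> {..<n} \<times> {..<m n} \<Longrightarrow> \<mu> n z \<in> \<D>"
  shows "(\<lambda>n. measure_pmf.prob (Pi_pmf ({..<n} \<times> {..<m n}) d (\<mu> n)) {M. det (mat n n M) = 0})
    \<longlonglongrightarrow> 0"
proof (rule LIMSEQ_I)
  fix \<eta> :: real assume eta: "0 < \<eta>"
  obtain L where "q ^ L < \<eta> / 3 * (1 - q)"
    using real_arch_pow_inv[of "\<eta> / 3 * (1 - q)" q] eta q by auto
  then have L: "q ^ L / (1 - q) < \<eta> / 3" using q by (simp add: field_simps)
  define \<delta> where "\<delta> = \<eta> / (3 * (real L + 1))"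
  have delta: "0 < \<delta>" "real L * \<delta> < \<eta> / 3" using eta by (auto simp: \<delta>_def field_simps)
  obtain s where s: "anticoncentrated (\<lambda>a \<nu>. a \<noteq> 0 \<and> \<nu> \<in> \<D>) \<delta> s"
    using anticoncentrated[OF delta(1)] by blast
  have "(\<lambda>n. real s / q ^ (L + s) * (real n ^ s * q ^ n)) \<longlonglongrightarrow> real s / q ^ (L + s) * 0"
    using q by (intro tendsto_mult_left power_mult_geometric_tendsto_0)
  then have "eventually (\<lambda>n. real s / q ^ (L + s) * (real n ^ s * q ^ n) < \<eta> / 3) sequentially"
    using eta by (intro order_tendstoD(2)) auto
  then obtain n0 where n0: "\<And>n. n0 \<le> n \<Longrightarrow> real s / q ^ (L + s) * (real n ^ s * q ^ n) < \<eta> / 3"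
    unfolding eventually_sequentially by blast
  show "\<exists>n0. \<forall>n\<ge>n0. norm (measure_pmf.prob (Pi_pmf ({..<n} \<times> {..<m n}) d (\<mu> n))
      {M. det (mat n n M) = 0} - 0) < \<eta>"
  proof (intro exI[of _ "max n0 (L + s)"] allI impI)
    fix n assume n: "max n0 (L + s) \<le> n"
    define k where "k = n - L"
    have k: "n = k + L" "n = (k - s) + (L + s)" using n by (auto simp: k_def)
    have "q ^ n = q ^ (k - s) * q ^ (L + s)" unfolding power_add[symmetric] k(2)[symmetric] ..
    then have "real s * real n ^ s * q ^ (k - s) = real s / q ^ (L + s) * (real n ^ s * q ^ n)"
      using q by simp
    then have "real s * real n ^ s * q ^ (k - s) < \<eta> / 3" using n0[of n] n by simp
    moreover have "measure_pmf.prob (Pi_pmf ({..<n} \<times> {..<m n}) d (\<mu> n)) {M. det (mat n n M) = 0}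
        \<le> q ^ L / (1 - q) + (real s * real n ^ s * q ^ (k - s) + real L * \<delta>)"
      using delta(1) by (intro prob_det_eq_0_le k(1) m mu s) auto
    ultimately have "measure_pmf.prob (Pi_pmf ({..<n} \<times> {..<m n}) d (\<mu> n))
        {M. det (mat n n M) = 0} < \<eta>"
      using L delta(2) by linarith
    then show "norm (measure_pmf.prob (Pi_pmf ({..<n} \<times> {..<m n}) d (\<mu> n))
        {M. det (mat n n M) = 0} - 0) < \<eta>" by simp
  qed
qed

end

lemma (in finite_residue_prime) eps_balanced_anticoncentrated_class:
  fixes \<epsilon> :: "'a set \<Rightarrow> real"
  assumes eps: "\<forall>I\<in>Ical. \<epsilon> I > 0"
  obtains q where "anticoncentrated_class {\<nu>. eps_balanced \<epsilon> \<nu>} q"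
proof -
  obtain e where e: "0 < e" "e < 1" and bal: "\<And>\<nu>. eps_balanced \<epsilon> \<nu> \<Longrightarrow> quot_balanced p e \<nu>"
    using quot_balanced_prime[OF eps] by blast
  have "anticoncentrated_class {\<nu>. eps_balanced \<epsilon> \<nu>} (1 - e)"
  proof
    show "0 < 1 - e" "1 - e < 1" using e by auto
    show "pmf \<nu> x \<le> 1 - e" if "\<nu> \<in> {\<nu>. eps_balanced \<epsilon> \<nu>}" for \<nu> x
      using that bal pmf_le by blast
    show "\<exists>s. anticoncentrated (\<lambda>a \<nu>. a \<noteq> 0 \<and> \<nu> \<in> {\<nu>. eps_balanced \<epsilon> \<nu>}) \<delta> s" if "0 < \<delta>" for \<delta>
      using anticoncentrated_eps_balanced[OF eps that] unfolding mem_Collect_eq by blast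
  qed
  then show thesis by (rule that)
qed


section \<open>The completed cokernel\<close>

lemma compatible_seq_sum:
  assumes "\<And>i. i \<in> A \<Longrightarrow> compatible_seq p (f i)"
  shows "compatible_seq p (\<lambda>m. \<Sum>i\<in>A. a i * f i m)"
  unfolding compatible_seq_def
proof
  fix m
  have "(\<Sum>i\<in>A. a i * f i (Suc m)) - (\<Sum>i\<in>A. a i * f i m) = (\<Sum>i\<in>A. a i * (f i (Suc m) - f i m))"
    by (simp add: sum_subtractf right_diff_distrib)
  also have "\<dots> \<in> ideal_pow p m"
    using assms by (intro ideal_sum[OF is_ideal_ideal_pow] ideal_mult_left[OF is_ideal_ideal_pow])
      (auto simp: compatible_seq_def)
  finally show "(\<Sum>i\<in>A. a i * f i (Suc m)) - (\<Sum>i\<in>A. a i * f i m) \<in> ideal_pow p m" .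
qed

lemma compatible_seq_diff:
  assumes "compatible_seq p x" "compatible_seq p y"
  shows "compatible_seq p (\<lambda>m. x m - y m)"
  unfolding compatible_seq_def
proof
  fix m
  have "(x (Suc m) - x m) - (y (Suc m) - y m) \<in> ideal_pow p m"
    by (rule ideal_diff[OF is_ideal_ideal_pow]) (use assms in \<open>auto simp: compatible_seq_def\<close>)
  then show "x (Suc m) - y (Suc m) - (x m - y m) \<in> ideal_pow p m" by (simp add: algebra_simps)
qed

lemma compatible_seq_diff_mem:
  assumes x: "compatible_seq p x" and "j \<le> m"
  shows "x m - x j \<in> ideal_pow p j"
  using \<open>j \<le> m\<close>
proof (induction m rule: dec_induct)
  case base
  show ?case using ideal_zero[OF is_ideal_ideal_pow] by simp
next
  case (step m)
  have "x (Suc m) - x m \<in> ideal_pow p j"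
    using x ideal_pow_antimono[OF step.hyps(1)] unfolding compatible_seq_def by blast
  from ideal_add[OF is_ideal_ideal_pow this step.IH] show ?case by simp
qed

lemma (in dedekind_prime) compatible_seq_divide:
  assumes d: "d \<noteq> 0" and x: "compatible_seq p x" "x (val d) \<in> ideal_pow p (val d)"
  obtains y where "compatible_seq p y" "\<And>m. x m - d * y m \<in> ideal_pow p m"
proof -
  define K where "K = val d"
  note pow_add = ideal_add[OF is_ideal_ideal_pow] and pow_diff = ideal_diff[OF is_ideal_ideal_pow]
  have "\<exists>y. x (m + K) - d * y \<in> ideal_pow p (m + K)" for m
  proof -
    have "(x (m + K) - x K) + x K \<in> ideal_pow p K"
      using x(2) by (intro pow_add compatible_seq_diff_mem[OF x(1)]) (auto simp: K_def)
    then show ?thesis using pow_divide[OF d, of "x (m + K)" m] by (auto simp: K_def)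
  qed
  then obtain y where y: "\<And>m. x (m + K) - d * y m \<in> ideal_pow p (m + K)" by metis
  show thesis
  proof (rule that[of y])
    have "y (Suc m) - y m \<in> ideal_pow p m" for m
    proof (rule pow_cancel[OF d])
      have "x (Suc m + K) - d * y (Suc m) \<in> ideal_pow p (m + K)"
        using y[of "Suc m"] ideal_pow_antimono[of "m + K" "Suc m + K"] by auto
      moreover have "x (Suc m + K) - x (m + K) \<in> ideal_pow p (m + K)"
        by (rule compatible_seq_diff_mem[OF x(1)]) simp
      ultimately have "(x (Suc m + K) - x (m + K)) + (x (m + K) - d * y m)
          - (x (Suc m + K) - d * y (Suc m)) \<in> ideal_pow p (m + K)"
        using y[of m] pow_add pow_diff by blast
      then show "d * (y (Suc m) - y m) \<in> ideal_pow p (val d + m)"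
        by (simp add: K_def right_diff_distrib add.commute)
    qed
    then show "compatible_seq p y" by (simp add: compatible_seq_def)
    fix m
    have "x (m + K) - d * y m \<in> ideal_pow p m"
      using y[of m] ideal_pow_antimono[of m "m + K"] by auto
    moreover have "x (m + K) - x m \<in> ideal_pow p m"
      by (rule compatible_seq_diff_mem[OF x(1)]) simp
    ultimately have "(x (m + K) - d * y m) - (x (m + K) - x m) \<in> ideal_pow p m" by (rule pow_diff)
    then show "x m - d * y m \<in> ideal_pow p m" by simp
  qed
qed

lemma Avec_iff:
  "v \<in> Avec P n \<longleftrightarrow> (\<forall>r<n. \<forall>p\<in>P. compatible_seq p (v r p))
    \<and> (\<forall>r p m. (n \<le> r \<or> p \<notin> P) \<longrightarrow> v r p m = 0)"
  unfolding Avec_def compl_prod_def by (auto simp: fun_eq_iff) (meson not_le)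

lemma cok_tensor_rel_iff:
  "(v, v') \<in> cok_tensor_rel P n u M \<longleftrightarrow> v \<in> Avec P n \<and> v' \<in> Avec P n \<and>
     (\<exists>w\<in>Avec P (n + u). \<forall>r<n. \<forall>p\<in>P. \<forall>m.
        v r p m - v' r p m - (\<Sum>c<n + u. M (r, c) * w c p m) \<in> ideal_pow p m)"
  by (simp add: cok_tensor_rel_def)

lemma Avec_diff:
  assumes "v \<in> Avec P n" "v' \<in> Avec P n"
  shows "(\<lambda>r p m. v r p m - v' r p m) \<in> Avec P n"
  using assms by (auto simp: Avec_iff intro: compatible_seq_diff)

lemma Avec_zero: "(\<lambda>r p m. 0) \<in> Avec P n"
  by (auto simp: Avec_iff compatible_seq_def ideal_zero[OF is_ideal_ideal_pow])

lemma equiv_cok_tensor_rel: "equiv (Avec P n) (cok_tensor_rel P n u M)"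
proof (rule equivI)
  let ?R = "cok_tensor_rel P n u M"
  show "?R \<subseteq> Avec P n \<times> Avec P n" by (auto simp: cok_tensor_rel_iff)
  have refl: "(v, v) \<in> ?R" if "v \<in> Avec P n" for v
    using that Avec_zero unfolding cok_tensor_rel_iff
    by (intro conjI bexI[of _ "\<lambda>r p m. 0"]) (auto simp: ideal_zero[OF is_ideal_ideal_pow])
  then show "refl_on (Avec P n) ?R" by (auto simp: refl_on_def)
  \<comment> \<open>Symmetry and transitivity both follow from this form of transitivity.\<close>
  have euclid: "(v2, v3) \<in> ?R" if v: "(v1, v2) \<in> ?R" "(v1, v3) \<in> ?R" for v1 v2 v3
  proof -
    obtain w w' where w: "w \<in> Avec P (n + u)" "w' \<in> Avec P (n + u)"
      and eq: "\<And>r p m. r < n \<Longrightarrow> p \<in> P \<Longrightarrow>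
          v1 r p m - v2 r p m - (\<Sum>c<n + u. M (r, c) * w c p m) \<in> ideal_pow p m"
        "\<And>r p m. r < n \<Longrightarrow> p \<in> P \<Longrightarrow>
          v1 r p m - v3 r p m - (\<Sum>c<n + u. M (r, c) * w' c p m) \<in> ideal_pow p m"
      using v unfolding cok_tensor_rel_iff by blast
    have "v2 r p m - v3 r p m - (\<Sum>c<n + u. M (r, c) * (w' c p m - w c p m)) \<in> ideal_pow p m"
      if "r < n" "p \<in> P" for r p m
      using ideal_diff[OF is_ideal_ideal_pow eq(2)[OF that, of m] eq(1)[OF that, of m]]
      by (simp add: right_diff_distrib sum_subtractf algebra_simps)
    then show ?thesis
      using v Avec_diff[OF w(2,1)] unfolding cok_tensor_rel_iff
      by (intro conjI bexI[of _ "\<lambda>r p m. w' r p m - w r p m"] allI impI ballI) auto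
  qed
  have sym: "(v', v) \<in> ?R" if vv: "(v, v') \<in> ?R" for v v'
    using euclid[OF vv refl] vv by (auto simp: cok_tensor_rel_iff)
  then show "sym ?R" by (rule symI)
  show "trans ?R"
  proof (rule transI)
    fix x y z assume "(x, y) \<in> ?R" "(y, z) \<in> ?R"
    then show "(x, z) \<in> ?R" using euclid[OF sym] by blast
  qed
qed

lemma cok_tensor_relI_divisible:
  assumes N: "\<And>r r'. r < n \<Longrightarrow> r' < n \<Longrightarrow>
      (\<Sum>c<n + u. M (r, c) * N c r') = (if r = r' then D else 0)"
    and v: "v \<in> Avec P n" "v' \<in> Avec P n"
    and divisible: "\<And>r p. r < n \<Longrightarrow> p \<in> P \<Longrightarrow>
      \<exists>y. compatible_seq p y \<and> (\<forall>m. v r p m - v' r p m - D * y m \<in> ideal_pow p m)"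
  shows "(v, v') \<in> cok_tensor_rel P n u M"
proof -
  obtain y where y: "\<And>r p. r < n \<Longrightarrow> p \<in> P \<Longrightarrow> compatible_seq p (y r p)"
    "\<And>r p m. r < n \<Longrightarrow> p \<in> P \<Longrightarrow> v r p m - v' r p m - D * y r p m \<in> ideal_pow p m"
    using divisible by metis
  define w where "w c p m = (if c < n + u \<and> p \<in> P then \<Sum>r<n. N c r * y r p m else 0)" for c p m
  have "compatible_seq p (w c p)" if "c < n + u" "p \<in> P" for c p
  proof -
    have "compatible_seq p (\<lambda>m. \<Sum>r<n. N c r * y r p m)"
      using y(1) that by (intro compatible_seq_sum) auto
    then show ?thesis using that by (simp add: w_def[abs_def])
  qed
  then have w: "w \<in> Avec P (n + u)" by (auto simp: Avec_iff w_def)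
  have "(\<Sum>c<n + u. M (r, c) * w c p m) = D * y r p m" if rp: "r < n" "p \<in> P" for r p m
  proof -
    have "(\<Sum>c<n + u. M (r, c) * w c p m) = (\<Sum>c<n + u. \<Sum>r'<n. M (r, c) * N c r' * y r' p m)"
      using rp by (intro sum.cong) (auto simp: w_def sum_distrib_left mult.assoc)
    also have "\<dots> = (\<Sum>r'<n. \<Sum>c<n + u. M (r, c) * N c r' * y r' p m)" by (rule sum.swap)
    also have "\<dots> = (\<Sum>r'<n. (if r = r' then D else 0) * y r' p m)"
      using N rp by (intro sum.cong) (auto simp flip: sum_distrib_right)
    also have "\<dots> = D * y r p m"
      using rp by (simp add: if_distrib[of "\<lambda>z. z * _"] cong: if_cong)
    finally show ?thesis .
  qed
  then show ?thesis
    unfolding cok_tensor_rel_iff using v w y(2) by (auto intro!: bexI[of _ w])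
qed

lemma adjugate_right_inverse:
  fixes M :: "nat \<times> nat \<Rightarrow> 'a::comm_ring_1"
  obtains N where "\<And>r r'. r < n \<Longrightarrow> r' < n \<Longrightarrow>
    (\<Sum>c<n + u. M (r, c) * N c r') = (if r = r' then det (mat n n M) else 0)"
proof -
  define A where "A = mat n n M"
  have A: "A \<in> carrier_mat n n" by (simp add: A_def)
  define N where "N c r' = (if c < n then adj_mat A $$ (c, r') else 0)" for c r'
  have "(\<Sum>c<n + u. M (r, c) * N c r') = (if r = r' then det A else 0)"
    if r: "r < n" "r' < n" for r r'
  proof -
    have "(\<Sum>c<n + u. M (r, c) * N c r') = (\<Sum>c<n. M (r, c) * adj_mat A $$ (c, r'))"
      by (rule sum.mono_neutral_cong_right) (auto simp: N_def)
    also have "\<dots> = (A * adj_mat A) $$ (r, r')"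
      using r adj_mat(1)[OF A] by (simp add: A_def scalar_prod_def lessThan_atLeast0)
    also have "\<dots> = (if r = r' then det A else 0)" using r by (simp add: adj_mat(2)[OF A])
    finally show ?thesis .
  qed
  then show thesis unfolding A_def by (rule that)
qed

lemma finite_quotient_of_invariant:
  assumes equiv: "equiv A R" and fin: "finite (f ` A)"
    and f: "\<And>x y. x \<in> A \<Longrightarrow> y \<in> A \<Longrightarrow> f x = f y \<Longrightarrow> (x, y) \<in> R"
  shows "finite (A // R)"
proof (rule finite_imageD)
  have "(`) f ` (A // R) \<subseteq> Pow (f ` A)"
    using in_quotient_imp_subset[OF equiv] by blast
  then show "finite ((`) f ` (A // R))" using fin by (meson finite_Pow_iff finite_subset)
  show "inj_on ((`) f) (A // R)"
  proof (rule inj_onI)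
    fix X Y assume XY: "X \<in> A // R" "Y \<in> A // R" and eq: "f ` X = f ` Y"
    obtain x where x: "x \<in> X" using in_quotient_imp_non_empty[OF equiv XY(1)] by blast
    then obtain y where "y \<in> Y" "f x = f y" using eq by blast
    then show "X = Y"
      using quotient_eqI[OF equiv XY x] f in_quotient_imp_subset[OF equiv] XY x by blast
  qed
qed

lemma finite_cok_tensor:
  fixes M :: "nat \<times> nat \<Rightarrow> 'a::idom"
  assumes P: "finite P" "\<And>p. p \<in> P \<Longrightarrow> finite_residue_prime p" and det: "det (mat n n M) \<noteq> 0"
  shows "finite (cok_tensor P n u M)"
proof -
  define D where "D = det (mat n n M)"
  define J where "J p = ideal_pow p (dedekind_prime.val p D)" for p
  define f where "f v = (\<lambda>(r, p)\<in>{..<n} \<times> P. residue_class (J p) (v r p (dedekind_prime.val p D)))"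
    for v :: "nat \<Rightarrow> 'a set \<Rightarrow> nat \<Rightarrow> 'a"
  have J: "finite_index_subgroup (J p)" if "p \<in> P" for p
    unfolding J_def using P(2)[OF that] by (rule finite_residue_prime.finite_index_pow)
  obtain N where N: "\<And>r r'. r < n \<Longrightarrow> r' < n \<Longrightarrow>
      (\<Sum>c<n + u. M (r, c) * N c r') = (if r = r' then D else 0)"
    unfolding D_def using adjugate_right_inverse by blast
  show ?thesis
    unfolding cok_tensor_def
  proof (rule finite_quotient_of_invariant[OF equiv_cok_tensor_rel, of f])
    have "f ` Avec P n \<subseteq> PiE ({..<n} \<times> P) (\<lambda>(r, p). quot (J p))"
      unfolding f_def using J
      by (intro image_subsetI restrict_PiE[THEN iffD2])
        (auto simp: finite_index_subgroup.residue_class_in_quot)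
    moreover have "finite (PiE ({..<n} \<times> P) (\<lambda>(r, p). quot (J p)))"
      using P(1) J by (intro finite_PiE) (auto simp: finite_index_subgroup_def)
    ultimately show "finite (f ` Avec P n)" by (rule finite_subset)
  next
    fix v v' assume v: "v \<in> Avec P n" "v' \<in> Avec P n" "f v = f v'"
    show "(v, v') \<in> cok_tensor_rel P n u M"
    proof (rule cok_tensor_relI_divisible[OF N v(1,2)])
      fix r p assume rp: "r < n" "p \<in> P"
      interpret finite_residue_prime p using P(2)[OF rp(2)] .
      have "D \<noteq> 0" using det by (simp add: D_def)
      moreover have "compatible_seq p (\<lambda>m. v r p m - v' r p m)"
        using v rp by (intro compatible_seq_diff) (auto simp: Avec_iff)
      moreover have "v r p (val D) - v' r p (val D) \<in> ideal_pow p (val D)"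
        using fun_cong[OF v(3), of "(r, p)"] rp
        by (simp add: f_def J_def
            residue_class_eq_iff[OF ideal_add_subgroup[OF is_ideal_ideal_pow]])
      ultimately show "\<exists>y. compatible_seq p y \<and> (\<forall>m. v r p m - v' r p m - D * y m \<in> ideal_pow p m)"
        by (rule compatible_seq_divide) blast
    qed
  qed
qed

lemma finite_cok_tensor_empty: "finite (cok_tensor {} n u M)"
proof -
  have "Avec {} n \<subseteq> {\<lambda>r p m. 0}" by (auto simp: Avec_iff fun_eq_iff)
  then have "finite (Avec {} n)" by (rule finite_subset) simp
  then show ?thesis unfolding cok_tensor_def quotient_def by (intro finite_UN_I) auto
qed

theorem theorem3p3:
  fixes \<epsilon> :: "'a::idom set \<Rightarrow> real"
    and P :: "'a set set"
    and u :: nat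
    and \<mu> :: "nat \<Rightarrow> nat \<Rightarrow> nat \<Rightarrow> 'a pmf"
  assumes "countable (UNIV :: 'a set)"
    and "dedekind_domain TYPE('a)"
    and "finite_residues TYPE('a)"
    and "\<forall>I\<in>Ical. \<epsilon> I > 0"
    and "finite P"
    and "\<forall>p\<in>P. is_prime_ideal p \<and> p \<noteq> {0}"
    and "u > 0"
    and "\<forall>n. \<forall>i<n. \<forall>j<n + u. eps_balanced \<epsilon> (\<mu> n i j)"
  shows "(\<lambda>n. measure_pmf.prob (matrix_law n u (\<mu> n)) {M. finite (cok_tensor P n u M)})
           \<longlonglongrightarrow> 1"
proof (cases "P = {}")
  case True
  then show ?thesis by (simp add: finite_cok_tensor_empty)
next
  case False
  let ?prob = "\<lambda>n. measure_pmf.prob (matrix_law n u (\<mu> n))"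
  have primes: "finite_residue_prime p" if "p \<in> P" for p
    using that assms(2,3,6) by unfold_locales auto
  with False assms(4) obtain q where "anticoncentrated_class {\<nu>. eps_balanced \<epsilon> \<nu>} q"
    by (metis all_not_in_conv finite_residue_prime.eps_balanced_anticoncentrated_class)
  then have singular: "(\<lambda>n. ?prob n {M. det (mat n n M) = 0}) \<longlonglongrightarrow> 0"
    unfolding matrix_law_def using assms(8)
    by (intro anticoncentrated_class.prob_det_eq_0_tendsto_0) auto
  have lower: "(\<lambda>n. 1 - ?prob n {M. det (mat n n M) = 0}) \<longlonglongrightarrow> 1"
    using tendsto_diff[OF tendsto_const singular, of 1] by simp
  have "1 - ?prob n {M. det (mat n n M) = 0} \<le> ?prob n {M. finite (cok_tensor P n u M)}" for n
  proof -
    have "- {M. det (mat n n M) = 0} \<subseteq> {M. finite (cok_tensor P n u M)}"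
      using finite_cok_tensor[OF assms(5) primes] by blast
    then have "?prob n (- {M. det (mat n n M) = 0}) \<le> ?prob n {M. finite (cok_tensor P n u M)}"
      by (intro measure_pmf.finite_measure_mono) auto
    then show ?thesis
      using measure_pmf.prob_compl[of "{M. det (mat n n M) = 0}" "matrix_law n u (\<mu> n)"]
      by (simp add: Compl_eq_Diff_UNIV)
  qed
  then show ?thesis
    by (intro tendsto_sandwich[OF _ _ lower tendsto_const] always_eventually) auto
qed

end
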